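(* Let $q$ be a complex number with $0<|q|<1$ and let $s,r$ be integers with $0\le s<r$. Let $\mathbf a=(a_1,\dots,a_r)\in\mathbb C^r$ satisfy $a_i-a_j\notin\mathbb Z$ for $1\le i<j\le r$, let $\mathbf b=(b_1,\dots,b_s)\in\mathbb C^s$ be arbitrary, and let $\mathbf m=(m_1,\dots,m_s)\in\mathbb Z^s$, $\mathbf n=(n_1,\dots,n_r)\in\mathbb Z^r$, $t\in\mathbb Z$. Put $$M=\sum_{i=1}^s m_i,\quad N=\sum_{i=1}^r n_i,\quad m_{\min}=\min_{1\le i\le s}m_i,\quad n_{\max}=\max_{1\le i\le r}n_i,$$ $$p'=\left[\frac{M-N-r-t+1}{r-s}\right],\quad K=\max(-m_{\min}-1,\,p')+(t)_+,\quad W=q^{t+r-1}\prod_{i=1}^r q^{a_i}\prod_{i=1}^s q^{-b_i},$$ where $[x]$ is the integer part (floor) of $x$. For integers $k\ge -n_{\max}$ define $$\beta_k=\sum_{j=\max(-n_{\max},\,k-(t)_+)}^{k}\begin{bmatrix}(t)_+\\ k-j\end{bmatrix}_q q^{(k-j)(k-j-1)/2}(-1)^{k-j}\sum_{i=1}^r\frac{q^{a_i(1-t)}\prod_{l=1}^s(q^{1-b_l+a_i};q)_{m_l+j}}{(q;q)_{j+n_i}\prod_{l\ne i}(q^{a_i-a_l};q)_{n_l+j+1}}$$ $$\times\;{}_{r+s}\phi_{r+s-1}\left(\begin{array}{c}q^{-j-n_i},\ (q^{b_l-a_i})_{1\le l\le s},\ (q^{a_l-a_i-n_l-j})_{l\ne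 i}\\ (q^{b_l-a_i-m_l-j})_{1\le l\le s},\ (q^{1-a_i+a_l})_{l\ne i}\end{array}\Big|\ q^{N-M+r-1+t+j(r-s)}\right),$$ where every term with $j+n_i<0$ is taken to be $0$. Then (for all $0<|z|<1$) $$\sum_{i=1}^r q^{a_i(1-t)}\frac{z^{-n_i}\prod_{l=1}^s(q^{1-b_l+a_i};q)_{m_l-n_i}}{\prod_{l\ne i}(q^{a_i-a_l};q)_{n_l-n_i+1}}\;{}_s\phi_{r-1}\left(\begin{array}{c}(q^{b_l-a_i})_{1\le l\le s}\\ (q^{1+a_l-a_i})_{l\ne i}\end{array}\Big|\ Wq^{(s-r)a_i}z\right)\;{}_s\hat\phi_{r-1}\left(\begin{array}{c}(q^{1-b_l+a_i+m_l-n_i})_{1\le l\le s}\\ (q^{1-a_l+a_i+n_l-n_i})_{l\ne i}\end{array}\Big|\ z\right)$$ $$=\frac{1}{(z;q)_{(t)_+}}\sum_{k=-n_{\max}}^{K}\beta_kz^k .$$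
   Context: A logarithm of $q$ is fixed and $q^x=\exp(x\log q)$ for $x\in\mathbb C$. For $n\ge 1$ the $q$-shifted factorial is $(a;q)_0=1$, $(a;q)_n=\prod_{k=0}^{n-1}(1-aq^k)$, $(a;q)_{-n}=\prod_{k=1}^{n}\frac{1}{1-aq^{-k}}$. In particular $1/(q;q)_{-n}=0$ for $n\ge1$. The basic hypergeometric function (base $q$ suppressed) is $${}_r\phi_{s}\left(\begin{array}{c}c_1,\dots,c_r\\ d_1,\dots,d_s\end{array}\Big|\ z\right)=\sum_{n=0}^\infty\frac{(c_1;q)_n\cdots(c_r;q)_n}{(d_1;q)_n\cdots(d_s;q)_n(q;q)_n}\left[(-1)^nq^{n(n-1)/2}\right]^{1+s-r}z^n ,\qquad r\le s+1;$$ it converges for all $z$ if $r\le s$ and for $|z|<1$ if $r=s+1$, and it terminates (so is defined for all $z$) if some upper parameter is $q^{-L}$ with $L\in\{0,1,2,\dots\}$. The Bailey–Slater version is $${}_r\hat\phi_{s}\left(\begin{array}{c}c_1,\dots,c_r\\ d_1,\dots,d_s\end{array}\Big|\ z\right)=\sum_{n=0}^\infty\frac{(c_1;q)_n\cdots(c_r;q)_n}{(d_1;q)_n\cdots(d_s;q)_n(q;q)_n}z^n .$$ $\begin{bmatrix}n\\ j\end{bmatrix}_q=\frac{(q;q)_n}{(q;q)_j(q;q)_{n-j}}$ is the $q$-binomial coefficient (zero for $j>n$ or $j<0$), and $(x)_+=\max(0,x)$. Empty sums are $0$, empty products are $1$; for $s=0$ one takes $m_{\min}=+\infty$, i.e.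 $K=p'+(t)_+$. "$l\neq i$" means $1\le l\le r$, $l\ne i$. The identity is understood for parameter values for which all expressions occurring in it are defined (no vanishing denominators). *)

theory Defs
  imports "HOL-Analysis.Analysis"
begin

text \<open>
  Throughout, \<open>lq\<close> is the fixed logarithm of the base \<open>q\<close>, i.e. \<open>exp lq = q\<close>, and
  \<open>qpow lq x\<close> is the power of \<open>q\<close> with complex exponent \<open>x\<close> taken with respect to it.
  Powers with integer exponents do not depend on the logarithm and are written with \<open>powi\<close>.
\<close>

definition qpow :: "complex \<Rightarrow> complex \<Rightarrow> complex" where
  "qpow lq x = exp (x * lq)"

text \<open>
  The \<open>q\<close>-shifted factorial with integer index. By the convention \<open>1 / 0 = 0\<close>, \<open>qfact\<close> is
  \<open>0\<close> when the index is negative and one of the factors \<open>1 - x * q powi (- k)\<close> vanishes; the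
  \<^emph>\<open>reciprocal\<close> \<open>1 / qfact q x n\<close> is then the correct value \<open>0\<close> of the product of these factors
  (e.g. for \<open>x = q\<close>), whereas \<open>qfact q x n\<close> itself is undefined in the usual sense. The latter
  is what \<open>qfact_defined\<close> rules out.
\<close>

definition qfact :: "complex \<Rightarrow> complex \<Rightarrow> int \<Rightarrow> complex" where
  "qfact q x n =
     (if 0 \<le> n then (\<Prod>k<nat n. 1 - x * q ^ k)
      else (\<Prod>k=1..nat (- n). 1 / (1 - x * q powi (- int k))))"

definition qfact_defined :: "complex \<Rightarrow> complex \<Rightarrow> int \<Rightarrow> bool" where
  "qfact_defined q x n \<longleftrightarrow> (\<forall>k::nat. 1 \<le> k \<and> int k \<le> - n \<longrightarrow> 1 - x * q powi (- int k) \<noteq> 0)"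

definition qbinomial :: "complex \<Rightarrow> int \<Rightarrow> int \<Rightarrow> complex" where
  "qbinomial q n j =
     (if 0 \<le> j \<and> j \<le> n then qfact q q n / (qfact q q j * qfact q q (n - j)) else 0)"

text \<open>
  The basic hypergeometric function with upper parameters \<open>cs\<close> and lower parameters \<open>ds\<close>, for
  \<open>length cs \<le> length ds + 1\<close> (so that the truncated subtraction is harmless), and its
  Bailey--Slater version. If the numerators vanish from some index on, the series is a finite
  sum, whatever the denominators are there, because \<open>0 / 0 = 0\<close>.
\<close>

definition qhyp :: "complex \<Rightarrow> complex list \<Rightarrow> complex list \<Rightarrow> complex \<Rightarrow> complex" where
  "qhyp q cs ds z =
     (\<Sum>n. (\<Prod>c\<leftarrow>cs. qfact q c (int n)) / ((\<Prod>d\<leftarrow>ds. qfact q d (int n)) * qfact q q (int n))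
        * ((-1) ^ n * q ^ (n * (n - 1) div 2)) ^ (1 + length ds - length cs) * z ^ n)"

definition qhyp_BS :: "complex \<Rightarrow> complex list \<Rightarrow> complex list \<Rightarrow> complex \<Rightarrow> complex" where
  "qhyp_BS q cs ds z =
     (\<Sum>n. (\<Prod>c\<leftarrow>cs. qfact q c (int n)) / ((\<Prod>d\<leftarrow>ds. qfact q d (int n)) * qfact q q (int n))
        * z ^ n)"

text \<open>The vectors are functions on \<open>{1..r}\<close> and \<open>{1..s}\<close>; values outside are never used.\<close>

definition idx :: "nat \<Rightarrow> nat list" where
  "idx s = [1..<Suc s]"

definition idx_except :: "nat \<Rightarrow> nat \<Rightarrow> nat list" where
  "idx_except r i = filter (\<lambda>l. l \<noteq> i) [1..<Suc r]"

definition nmax :: "nat \<Rightarrow> (nat \<Rightarrow> int) \<Rightarrow> int" where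
  "nmax r n = Max (n ` {1..r})"

definition pprime :: "nat \<Rightarrow> nat \<Rightarrow> (nat \<Rightarrow> int) \<Rightarrow> (nat \<Rightarrow> int) \<Rightarrow> int \<Rightarrow> int" where
  "pprime r s m n t =
     \<lfloor>real_of_int ((\<Sum>l=1..s. m l) - (\<Sum>i=1..r. n i) - int r - t + 1) / real_of_int (int r - int s)\<rfloor>"

definition Kbound :: "nat \<Rightarrow> nat \<Rightarrow> (nat \<Rightarrow> int) \<Rightarrow> (nat \<Rightarrow> int) \<Rightarrow> int \<Rightarrow> int" where
  "Kbound r s m n t =
     (if s = 0 then pprime r s m n t
      else max (- Min (m ` {1..s}) - 1) (pprime r s m n t)) + max 0 t"

definition Wconst :: "complex \<Rightarrow> complex \<Rightarrow> nat \<Rightarrow> nat \<Rightarrow> (nat \<Rightarrow> complex) \<Rightarrow> (nat \<Rightarrow> complex) \<Rightarrow> int \<Rightarrow> complex" where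
  "Wconst q lq r s a b t =
     q powi (t + int r - 1) * (\<Prod>i=1..r. qpow lq (a i)) * (\<Prod>l=1..s. qpow lq (- b l))"

definition beta_term ::
  "complex \<Rightarrow> complex \<Rightarrow> nat \<Rightarrow> nat \<Rightarrow> (nat \<Rightarrow> complex) \<Rightarrow> (nat \<Rightarrow> complex) \<Rightarrow>
   (nat \<Rightarrow> int) \<Rightarrow> (nat \<Rightarrow> int) \<Rightarrow> int \<Rightarrow> int \<Rightarrow> nat \<Rightarrow> complex" where
  "beta_term q lq r s a b m n t j i =
     (if j + n i < 0 then 0
      else
        qpow lq (a i * (1 - of_int t)) * (\<Prod>l=1..s. qfact q (qpow lq (1 - b l + a i)) (m l + j))
        / (qfact q q (j + n i)
           * (\<Prod>l\<in>{1..r} - {i}. qfact q (qpow lq (a i - a l)) (n l + j + 1)))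
        * qhyp q
            (q powi (- j - n i)
              # map (\<lambda>l. qpow lq (b l - a i)) (idx s)
              @ map (\<lambda>l. qpow lq (a l - a i - of_int (n l) - of_int j)) (idx_except r i))
            (map (\<lambda>l. qpow lq (b l - a i - of_int (m l) - of_int j)) (idx s)
              @ map (\<lambda>l. qpow lq (1 - a i + a l)) (idx_except r i))
            (q powi ((\<Sum>i=1..r. n i) - (\<Sum>l=1..s. m l) + int r - 1 + t + j * (int r - int s))))"

definition beta ::
  "complex \<Rightarrow> complex \<Rightarrow> nat \<Rightarrow> nat \<Rightarrow> (nat \<Rightarrow> complex) \<Rightarrow> (nat \<Rightarrow> complex) \<Rightarrow>
   (nat \<Rightarrow> int) \<Rightarrow> (nat \<Rightarrow> int) \<Rightarrow> int \<Rightarrow> int \<Rightarrow> complex" where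
  "beta q lq r s a b m n t k =
     (\<Sum>j = max (- nmax r n) (k - max 0 t)..k.
        qbinomial q (max 0 t) (k - j) * q powi ((k - j) * (k - j - 1) div 2) * (-1) powi (k - j)
        * (\<Sum>i=1..r. beta_term q lq r s a b m n t j i))"

end

theory Submission
  imports Defs "HOL-Computational_Algebra.Polynomial_FPS"
begin

text \<open>
  Write \<open>X\<^sub>i = q\<^bsup>a\<^sub>i\<^esup>\<close> and \<open>B\<^sub>l = q\<^bsup>b\<^sub>l\<^esup>\<close>. The identity is a statement about the residues of the functions
  \<open>x\<^bsup>-t\<^esup> f\<^sub>j(x)\<close>, where
  \<open>f\<^sub>j(x) = (\<Prod>l. (q x / B\<^sub>l; q)\<^bsub>m\<^sub>l + j\<^esub>) / (\<Prod>i. (x / X\<^sub>i; q)\<^bsub>n\<^sub>i + j + 1\<^esub>)\<close>.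
  Multiplying out the two series on the left, the coefficient \<open>\<alpha> j\<close> of \<open>z\<^bsup>j\<^esup>\<close> is a double sum over \<open>i\<close> and
  \<open>0 \<le> h \<le> n\<^sub>i + j\<close>, and its \<open>(i, h)\<close> term is, up to sign, the residue of \<open>x\<^bsup>-t\<^esup> f\<^sub>j(x)\<close> at
  \<open>x = X\<^sub>i q\<^bsup>-h\<^esup>\<close> (\<open>product_coeff\<close>, \<open>\<kappa>_residue\<close>). The terminating series in \<open>beta_term\<close> is the same sum over
  \<open>h\<close> with the shifted factorials reversed (\<open>\<kappa>_beta\<close>), so every \<open>beta\<close> is a convolution of the \<open>\<alpha> j\<close>
  with the coefficients of \<open>(z; q)\<^sub>T\<close>, \<open>T = max 0 t\<close>, given by the finite \<open>q\<close>-binomial theorem. What has to be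
  shown is that this convolution vanishes beyond \<open>Kbound\<close>.

  Let \<open>j\<close> exceed both \<open>-m\<^sub>m\<^sub>i\<^sub>n - 1\<close> and \<open>p'\<close>. Then the factors with \<open>B\<^sub>l\<close> are polynomials, so the points
  \<open>X\<^sub>i q\<^bsup>-h\<^esup>\<close> are the only poles apart from \<open>0\<close> and infinity; they are simple because
  no \<open>X\<^sub>i / X\<^sub>l\<close> is an integer power of \<open>q\<close>, which is what the nonvanishing denominators express
  (\<open>ratio_not_q_power\<close>). The degree condition \<open>j > p'\<close> excludes a residue at infinity. Hence \<open>\<alpha> j\<close> is the residue at \<open>0\<close>,
  which is the coefficient of \<open>x\<^bsup>t-1\<^esup>\<close> in the power series of \<open>f\<^sub>j\<close>, and \<open>0\<close> for \<open>t \<le> 0\<close>. This residue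
  theorem is purely algebraic: it is Lagrange interpolation (\<open>residue_sum\<close>).

  Now \<open>(u x; q)\<^sub>k = (u x; q)\<^sub>\<infinity> / (u q\<^bsup>k\<^esup> x; q)\<^sub>\<infinity>\<close> shows that \<open>f\<^sub>j(x) = G(x) H(q\<^bsup>j\<^esup> x)\<close> for power
  series \<open>G\<close>, \<open>H\<close> that do not depend on \<open>j\<close> (\<open>shifted_product_fps\<close>). Therefore \<open>\<alpha> j\<close> is, for these \<open>j\<close>, a linear
  combination of the sequences \<open>q\<^bsup>j e\<^esup>\<close> with \<open>0 \<le> e < t\<close> (\<open>\<alpha>_polynomial\<close>). Convolution with the coefficients
  of \<open>(z; q)\<^sub>t\<close> multiplies \<open>q\<^bsup>j e\<^esup>\<close> by \<open>(q\<^bsup>-e\<^esup>; q)\<^sub>t = 0\<close> (\<open>q_binomial_annihilates\<close>), which gives the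
  vanishing (\<open>\<alpha>_convolution_vanishes\<close>).

  The exponents \<open>a\<^sub>i\<close>, \<open>b\<^sub>l\<close> enter only through \<open>X\<^sub>i\<close> and \<open>B\<^sub>l\<close>; the argument is carried out for these
  numbers, and the complex exponents return at the end.
\<close>

section \<open>Shifted factorials with integer index\<close>

lemma qfact_int: "qfact q x (int n) = (\<Prod>k<n. 1 - x * q ^ k)"
  by (simp add: qfact_def)

lemma qfact_int_Suc: "qfact q x (int (Suc n)) = qfact q x (int n) * (1 - x * q ^ n)"
  by (simp only: qfact_int prod.lessThan_Suc)

lemma qfact_0 [simp]: "qfact q x 0 = 1"
  by (simp add: qfact_def)

lemma powi_minus_Suc:
  fixes q :: complex
  assumes "q \<noteq> 0"
  shows "q powi (- int (Suc k)) * q = q powi (- int k)"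
  using assms by (simp add: power_int_minus field_simps del: of_nat_Suc)

lemma qfact_neg: "qfact q x (- int n) = (\<Prod>k=1..n. 1 / (1 - x * q powi (- int k)))"
  by (cases "n = 0") (auto simp: qfact_def)

lemma qfact_defined_mono: "qfact_defined q x n \<Longrightarrow> n \<le> n' \<Longrightarrow> qfact_defined q x n'"
  by (auto simp: qfact_defined_def)

text \<open>
  For a negative index the left-hand side has one factor fewer, and definedness is what allows that
  factor to be cancelled.
\<close>

lemma qfact_step:
  assumes "q \<noteq> 0" "qfact_defined q x n"
  shows "qfact q x (n + 1) = qfact q x n * (1 - x * q powi n)"
proof (cases "0 \<le> n")
  case True
  then obtain N where "n = int N" using nonneg_int_cases by blast
  then show ?thesis using qfact_int_Suc[of q x N] by (simp add: add.commute)
next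
  case False
  then obtain N where N: "n = - int (Suc N)" by (metis int_cases not_less zero_less_Suc of_nat_0_le_iff)
  have "1 - x * q powi n \<noteq> 0"
    using assms(2) N unfolding qfact_defined_def by (metis le_add1 minus_minus order_refl plus_1_eq_Suc)
  moreover have "n + 1 = - int N" using N by simp
  ultimately show ?thesis by (simp only: N qfact_neg) simp
qed

lemma qfact_add:
  assumes "q \<noteq> 0" "qfact_defined q x n"
  shows "qfact q x (n + int h) = qfact q x n * qfact q (x * q powi n) (int h)"
proof (induction h)
  case (Suc h)
  have "qfact q x (n + int (Suc h)) = qfact q x (n + int h + 1)"
    by (simp add: algebra_simps)
  also have "\<dots> = qfact q x (n + int h) * (1 - x * q powi (n + int h))"
    using assms qfact_defined_mono by (intro qfact_step) auto
  finally show ?case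
    using assms by (simp only: Suc qfact_int_Suc) (simp add: power_int_add mult.assoc)
qed simp

lemma qfact_int_step_front:
  "qfact q x (int (Suc n)) = (1 - x) * qfact q (x * q) (int n)"
  unfolding qfact_int prod.lessThan_Suc_shift by (simp add: mult.assoc)

text \<open>
  Peeling off the first instead of the last factor; here definedness at \<open>x q\<close> is the right condition,
  since for a negative index it includes \<open>x \<noteq> 1\<close>.
\<close>

lemma qfact_step_front:
  assumes "q \<noteq> 0" "qfact_defined q (x * q) (n - 1)"
  shows "qfact q x n = (1 - x) * qfact q (x * q) (n - 1)"
proof (cases "0 < n")
  case True
  then obtain N where "n = int (Suc N)" by (metis gr0_conv_Suc zero_less_imp_eq_int)
  then show ?thesis using qfact_int_step_front[of q x N] by simp
next
  case False
  then obtain N where N: "n = - int N" by (metis int_cases2 not_less of_nat_0_le_iff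
        dual_order.antisym neg_le_0_iff_le zero_less_imp_eq_int linorder_neqE minus_zero of_nat_0)
  have N1: "n - 1 = - int (Suc N)" using N by simp
  have sh: "x * q * q powi (- int (Suc k)) = x * q powi (- int k)" for k
    using powi_minus_Suc[OF assms(1), of k] by (simp add: mult_ac del: of_nat_Suc)
  have "1 - x * q * q powi (- int (Suc 0)) \<noteq> 0"
    using assms(2) N1 unfolding qfact_defined_def by (metis One_nat_def Suc_le_mono le0 minus_minus of_nat_le_iff order_refl)
  then have "1 - x \<noteq> 0" unfolding sh by simp
  have "qfact q (x * q) (n - 1) = (\<Prod>k\<in>Suc ` {0..N}. 1 / (1 - x * q * q powi (- int k)))"
    unfolding N1 qfact_neg by (simp only: image_Suc_atLeastAtMost One_nat_def)
  also have "\<dots> = (\<Prod>k=0..N. 1 / (1 - x * q powi (- int k)))"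
    by (subst prod.reindex) (simp_all only: o_def sh inj_Suc inj_on_subset[OF _ subset_UNIV])
  also have "\<dots> = 1 / (1 - x) * (\<Prod>k=1..N. 1 / (1 - x * q powi (- int k)))"
    by (subst prod.atLeast_Suc_atMost) auto
  finally show ?thesis using \<open>1 - x \<noteq> 0\<close> by (simp only: N qfact_neg) simp
qed

text \<open>
  Splitting at the index \<open>h\<close>, where \<open>n - h\<close> may be negative. This evaluates a shifted factorial at the pole
  \<open>y q\<^bsup>-h\<^esup>\<close> in terms of its value at \<open>y\<close>.
\<close>

lemma qfact_shift:
  assumes "q \<noteq> 0" "qfact_defined q y (n - int h)"
  shows "qfact q (y * q powi (- int h)) n = qfact q (y * q powi (- int h)) (int h) * qfact q y (n - int h)"
  using assms(2)
proof (induction h arbitrary: n)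
  case (Suc h)
  have sh: "y * q powi (- int (Suc h)) * q = y * q powi (- int h)"
    using powi_minus_Suc[OF assms(1), of h] by (simp only: mult.assoc)
  have "qfact_defined q (y * q powi (- int h)) (n - 1)"
    unfolding qfact_defined_def
  proof (intro allI impI)
    fix k :: nat assume k: "1 \<le> k \<and> int k \<le> - (n - 1)"
    then have "1 \<le> k + h \<and> int (k + h) \<le> - (n - int (Suc h))"
      by linarith
    then have "1 - y * q powi (- int (k + h)) \<noteq> 0"
      using Suc.prems unfolding qfact_defined_def by blast
    moreover have "q powi (- int (k + h)) = q powi (- int h) * q powi (- int k)"
      using assms(1) power_int_add[of q "- int h" "- int k"] by (simp add: algebra_simps)
    ultimately show "1 - y * q powi (- int h) * q powi (- int k) \<noteq> 0"
      by (simp only: mult.assoc) simp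
  qed
  then have "qfact q (y * q powi (- int (Suc h))) n
      = (1 - y * q powi (- int (Suc h))) * qfact q (y * q powi (- int h)) (n - 1)"
    using qfact_step_front[OF assms(1), of "y * q powi (- int (Suc h))" n] unfolding sh by blast
  also have "qfact q (y * q powi (- int h)) (n - 1)
      = qfact q (y * q powi (- int h)) (int h) * qfact q y (n - int (Suc h))"
    using Suc.IH[of "n - 1"] Suc.prems by (simp add: algebra_simps)
  also have "(1 - y * q powi (- int (Suc h))) * (qfact q (y * q powi (- int h)) (int h) * qfact q y (n - int (Suc h)))
     = qfact q (y * q powi (- int (Suc h))) (int (Suc h)) * qfact q y (n - int (Suc h))"
    unfolding qfact_int_step_front sh by simp
  finally show ?case .
qed simp

text \<open>
  The sign and \<open>q\<close>-power of a reversed factorial; it is also the bracket in \<open>qhyp\<close>.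
\<close>

definition qsign :: "complex \<Rightarrow> nat \<Rightarrow> complex" where
  "qsign q h = (-1) ^ h * q ^ (h * (h - 1) div 2)"

lemma qsign_0 [simp]: "qsign q 0 = 1" by (simp add: qsign_def)

lemma qsign_Suc: "qsign q (Suc h) = - (q ^ h) * qsign q h"
proof -
  have "Suc h * (Suc h - 1) div 2 = h * (h - 1) div 2 + h"
    by (cases h) auto
  then show ?thesis by (simp add: qsign_def power_add)
qed

lemma qsign_nonzero: "q \<noteq> 0 \<Longrightarrow> qsign q h \<noteq> 0"
  by (simp add: qsign_def)

text \<open>
  All passages between a parameter and its reciprocal come from this reversal of a finite product.
  Keeping the power of \<open>q\<close> inside \<open>qsign\<close> means that later only the exponents of \<open>qsign\<close> have to be counted.
\<close>

lemma qfact_reverse: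
  assumes "q \<noteq> 0" "y \<noteq> 0"
  shows "qfact q (y * q powi (1 - int h)) (int h) = y ^ h * qfact q (1 / y) (int h) / qsign q h"
proof (induction h)
  case (Suc h)
  have sh: "y * q powi (1 - int (Suc h)) * q = y * q powi (1 - int h)"
    using assms(1) by (simp add: power_int_minus power_int_diff divide_inverse)
  have e: "y * q powi (1 - int (Suc h)) = y / q ^ h"
    by (simp add: power_int_minus divide_inverse)
  have "qfact q (y * q powi (1 - int (Suc h))) (int (Suc h))
     = (1 - y / q ^ h) * (y ^ h * qfact q (1 / y) (int h) / qsign q h)"
    unfolding qfact_int_step_front sh Suc unfolding e ..
  also have "\<dots> = y ^ Suc h * qfact q (1 / y) (int (Suc h)) / qsign q (Suc h)"
    using assms qsign_nonzero[of q h] by (simp only: qfact_int_Suc qsign_Suc) (simp add: field_simps)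
  finally show ?case .
qed simp

section \<open>Lagrange interpolation and sums of residues\<close>

text \<open>
  The nodes are written as \<open>1 / u i\<close> because the poles occur as zeros of \<open>1 - u i x\<close>. Both sides have degree
  below the number of nodes and agree at each node.
\<close>

lemma lagrange_interpolation:
  fixes u :: "'i \<Rightarrow> complex" and P :: "complex poly"
  assumes fin: "finite I" and inj: "inj_on u I" and nz: "\<And>i. i \<in> I \<Longrightarrow> u i \<noteq> 0"
    and deg: "degree P < card I"
  shows "P = (\<Sum>i\<in>I. smult (poly P (1 / u i) / (\<Prod>k\<in>I - {i}. 1 - u k / u i))
                          (\<Prod>k\<in>I - {i}. [:1, - u k:]))" (is "P = ?R")
proof (rule poly_eqI_degree)
  fix x assume "x \<in> (\<lambda>i. 1 / u i) ` I"
  then obtain i where i: "i \<in> I" "x = 1 / u i" by blast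
  have ne: "(\<Prod>k\<in>I - {i}. 1 - u k / u i) \<noteq> 0"
    using inj i nz fin by (auto simp: inj_on_def)
  have "poly ?R x = (\<Sum>j\<in>I. poly P (1 / u j) / (\<Prod>k\<in>I - {j}. 1 - u k / u j)
           * (\<Prod>k\<in>I - {j}. 1 - u k / u i))"
    by (simp add: poly_sum poly_prod i)
  also have "\<dots> = (\<Sum>j\<in>I. if j = i then poly P x else 0)"
  proof (rule sum.cong)
    fix j assume j: "j \<in> I"
    show "poly P (1 / u j) / (\<Prod>k\<in>I - {j}. 1 - u k / u j) * (\<Prod>k\<in>I - {j}. 1 - u k / u i)
          = (if j = i then poly P x else 0)"
    proof (cases "j = i")
      case False
      then have "(\<Prod>k\<in>I - {j}. 1 - u k / u i) = 0"
        using i fin nz[of i] by (intro prod_zero) auto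
      then show ?thesis using False by simp
    qed (use ne i in auto)
  qed simp
  also have "\<dots> = poly P x" using fin i by simp
  finally show "poly P x = poly ?R x" ..
next
  have card: "card ((\<lambda>i. 1 / u i) ` I) = card I"
    using inj by (intro card_image) (auto simp: inj_on_def)
  show "degree P < card ((\<lambda>i. 1 / u i) ` I)" using deg card by simp
  have "degree ?R \<le> card I - 1"
  proof (intro degree_sum_le fin)
    fix i assume i: "i \<in> I"
    have "degree (\<Prod>k\<in>I - {i}. [:1, - u k:]) \<le> sum (degree \<circ> (\<lambda>k. [:1, - u k:])) (I - {i})"
      using fin by (intro degree_prod_sum_le) auto
    also have "\<dots> \<le> (\<Sum>k\<in>I - {i}. 1)"
      by (intro sum_mono) (simp add: o_def)
    finally have "degree (\<Prod>k\<in>I - {i}. [:1, - u k:]) \<le> card I - 1" using fin i by simp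
    then show "degree (smult (poly P (1 / u i) / (\<Prod>k\<in>I - {i}. 1 - u k / u i))
                          (\<Prod>k\<in>I - {i}. [:1, - u k:])) \<le> card I - 1"
      by (meson degree_smult_le le_trans)
  qed
  then show "degree ?R < card ((\<lambda>i. 1 / u i) ` I)" using deg card by linarith
qed

lemma geometric_fps:
  fixes u :: complex
  shows "fps_of_poly [:1, - u:] * Abs_fps (\<lambda>n. u ^ n) = 1"
proof -
  have p: "fps_of_poly [:1, - u:] = 1 - fps_const u * fps_X"
    by (simp add: fps_of_poly_pCons)
  show ?thesis
  proof (rule fps_ext)
    fix n
    show "fps_nth (fps_of_poly [:1, - u:] * Abs_fps (\<lambda>n. u ^ n)) n = fps_nth 1 n"
      unfolding p by (cases n) (simp_all add: left_diff_distrib mult.assoc)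
  qed
qed

text \<open>
  The residue theorem for \<open>x\<^bsup>-(e+1)\<^esup> Q(x) / (\<Prod>i. 1 - u\<^sub>i x)\<close>: the finite simple poles contribute minus the
  left-hand side, the pole at \<open>0\<close> contributes the coefficient of \<open>x\<^bsup>e\<^esup>\<close> on the right, and the degree bound makes
  the residue at infinity vanish. Lagrange interpolation of the constant \<open>1\<close> gives the partial fraction
  expansion of the reciprocal of the denominator, hence the claim for monomials of degree at most \<open>e\<close>.
  Interpolation of higher monomials, evaluated at \<open>0\<close>, shows that these contribute nothing.
\<close>

lemma residue_sum:
  fixes u :: "'i \<Rightarrow> complex" and Q :: "complex poly" and F :: "complex fps"
  assumes fin: "finite I" and inj: "inj_on u I" and nz: "\<And>i. i \<in> I \<Longrightarrow> u i \<noteq> 0"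
    and deg: "degree Q < card I + e"
    and F: "F * fps_of_poly (\<Prod>i\<in>I. [:1, - u i:]) = fps_of_poly Q"
  shows "(\<Sum>i\<in>I. poly Q (1 / u i) * u i ^ e / (\<Prod>k\<in>I - {i}. 1 - u k / u i)) = fps_nth F e"
proof (cases "I = {}")
  case True
  then show ?thesis using F deg by (simp add: coeff_eq_0)
next
  case False
  define c where "c i = 1 / (\<Prod>k\<in>I - {i}. 1 - u k / u i)" for i
  define V where "V = (\<Sum>i\<in>I. fps_const (c i) * Abs_fps (\<lambda>n. u i ^ n))"
  have "(1 :: complex poly) = (\<Sum>i\<in>I. smult (c i) (\<Prod>k\<in>I - {i}. [:1, - u k:]))"
    using lagrange_interpolation[OF fin inj nz, of 1] False fin by (simp add: c_def card_gt_0_iff)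
  from arg_cong[OF this, of fps_of_poly]
  have one: "(1 :: complex fps) = (\<Sum>i\<in>I. fps_const (c i) * fps_of_poly (\<Prod>k\<in>I - {i}. [:1, - u k:]))"
    by (simp only: fps_of_poly_1 fps_of_poly_smult fps_of_poly_sum)
  have "fps_of_poly (\<Prod>i\<in>I. [:1, - u i:]) * V
      = (\<Sum>i\<in>I. fps_const (c i) * fps_of_poly (\<Prod>k\<in>I - {i}. [:1, - u k:])
           * (fps_of_poly [:1, - u i:] * Abs_fps (\<lambda>n. u i ^ n)))"
    unfolding V_def sum_distrib_left
  proof (rule sum.cong)
    fix i assume i: "i \<in> I"
    have "fps_of_poly (\<Prod>k\<in>I. [:1, - u k:])
        = fps_of_poly [:1, - u i:] * fps_of_poly (\<Prod>k\<in>I - {i}. [:1, - u k:])"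
      unfolding fps_of_poly_mult[symmetric] using prod.remove[OF fin i, of "\<lambda>k. [:1, - u k:]"] by simp
    then show "fps_of_poly (\<Prod>k\<in>I. [:1, - u k:]) * (fps_const (c i) * Abs_fps (\<lambda>n. u i ^ n))
       = fps_const (c i) * fps_of_poly (\<Prod>k\<in>I - {i}. [:1, - u k:])
           * (fps_of_poly [:1, - u i:] * Abs_fps (\<lambda>n. u i ^ n))"
      by (simp only: mult_ac)
  qed simp
  also have "\<dots> = 1" unfolding geometric_fps mult_1_right by (rule one[symmetric])
  finally have DV: "fps_of_poly (\<Prod>i\<in>I. [:1, - u i:]) * V = 1" .
  have "F = F * (fps_of_poly (\<Prod>i\<in>I. [:1, - u i:]) * V)" by (simp only: DV mult_1_right)
  then have FV: "F = fps_of_poly Q * V" unfolding mult.assoc[symmetric] F .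
  define N where "N = max e (degree Q)"
  have V_nth: "fps_nth V n = (\<Sum>i\<in>I. c i * u i ^ n)" for n
    by (simp add: V_def fps_sum_nth)
  have mono: "coeff Q k * (\<Sum>i\<in>I. c i * ((1 / u i) ^ k * u i ^ e))
        = (if k \<le> e then coeff Q k * fps_nth V (e - k) else 0)" for k
  proof (cases "k \<le> e \<or> degree Q < k")
    case True
    have "(1 / u i) ^ k * u i ^ e = u i ^ (e - k)" if "i \<in> I" "k \<le> e" for i
      using nz[OF that(1)] that(2) by (simp add: power_diff field_simps)
    then show ?thesis using True by (auto simp: V_nth coeff_eq_0)
  next
    case False
    \<comment> \<open>the interpolated monomial has positive degree, so its value at \<open>0\<close> vanishes\<close>
    define P where "P = monom (1::complex) (k - e)"
    have "degree P < card I"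
      unfolding P_def degree_monom_eq[OF one_neq_zero] using False deg by linarith
    then have "poly P 0 = poly (\<Sum>i\<in>I. smult (poly P (1 / u i) / (\<Prod>k\<in>I - {i}. 1 - u k / u i))
                          (\<Prod>k\<in>I - {i}. [:1, - u k:])) 0"
      using arg_cong[OF lagrange_interpolation[OF fin inj nz], where f = "\<lambda>p. poly p 0"] by blast
    also have "\<dots> = (\<Sum>i\<in>I. c i * (1 / u i) ^ (k - e))"
      by (simp add: poly_sum poly_prod P_def poly_monom c_def)
    also have "\<dots> = (\<Sum>i\<in>I. c i * ((1 / u i) ^ k * u i ^ e))"
      using nz False by (intro sum.cong) (auto simp: power_diff field_simps)
    finally show ?thesis using False by (simp add: P_def poly_monom power_0_left)
  qed
  have "(\<Sum>i\<in>I. poly Q (1 / u i) * u i ^ e / (\<Prod>k\<in>I - {i}. 1 - u k / u i))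
      = (\<Sum>i\<in>I. \<Sum>k\<le>N. coeff Q k * (c i * ((1 / u i) ^ k * u i ^ e)))"
  proof (rule sum.cong)
    fix i assume "i \<in> I"
    have "poly Q (1 / u i) = (\<Sum>k\<le>N. coeff Q k * (1 / u i) ^ k)"
      unfolding poly_altdef by (rule sum.mono_neutral_left) (auto simp: N_def coeff_eq_0)
    then show "poly Q (1 / u i) * u i ^ e / (\<Prod>k\<in>I - {i}. 1 - u k / u i)
        = (\<Sum>k\<le>N. coeff Q k * (c i * ((1 / u i) ^ k * u i ^ e)))"
      by (simp add: c_def sum_distrib_right sum_divide_distrib mult.assoc)
  qed simp
  also have "\<dots> = (\<Sum>k\<le>N. coeff Q k * (\<Sum>i\<in>I. c i * ((1 / u i) ^ k * u i ^ e)))"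
    by (subst sum.swap) (simp add: sum_distrib_left)
  also have "\<dots> = (\<Sum>k\<le>N. if k \<le> e then coeff Q k * fps_nth V (e - k) else 0)"
    by (simp only: mono)
  also have "\<dots> = (\<Sum>k=0..e. coeff Q k * fps_nth V (e - k))"
    by (rule sum.mono_neutral_cong_right) (auto simp: N_def)
  also have "\<dots> = fps_nth F e" by (simp add: FV fps_mult_nth)
  finally show ?thesis .
qed

section \<open>Infinite products as formal power series\<close>

text \<open>
  The expansion of the infinite product \<open>(u x; q)\<^sub>\<infinity>\<close> in powers of \<open>x\<close>, due to Euler. Taking the formal series
  instead of the product makes questions of convergence disappear; only the functional equation \<open>qinf_rec\<close> and
  the dependence on \<open>u\<close> in \<open>qinf_scale\<close> matter.
\<close>

definition qinf :: "complex \<Rightarrow> complex \<Rightarrow> complex fps" where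
  "qinf q u = Abs_fps (\<lambda>n. u ^ n * (\<Prod>k<n. - (q ^ k) / (1 - q ^ Suc k)))"

definition qpoly :: "complex \<Rightarrow> complex \<Rightarrow> nat \<Rightarrow> complex poly" where
  "qpoly q u N = (\<Prod>k<N. [:1, - (u * q ^ k):])"

lemma power_neq_one:
  fixes q :: complex
  assumes "norm q < 1"
  shows "q ^ Suc n \<noteq> 1"
proof
  assume "q ^ Suc n = 1"
  then have "norm q ^ Suc n = 1" by (metis norm_power norm_one)
  moreover have "norm q ^ Suc n \<le> norm q ^ 1"
    using assms by (intro power_decreasing) auto
  ultimately show False using assms by simp
qed

lemma qinf_nth_0 [simp]: "fps_nth (qinf q u) 0 = 1"
  by (simp add: qinf_def)

lemma qinf_rec:
  assumes "norm q < 1"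
  shows "qinf q u = fps_of_poly [:1, - u:] * qinf q (u * q)"
proof -
  define c where "c n = (\<Prod>k<n. - (q ^ k) / (1 - q ^ Suc k))" for n
  have p: "fps_of_poly [:1, - u:] = 1 - fps_const u * fps_X"
    by (simp add: fps_of_poly_pCons)
  show ?thesis
  proof (rule fps_ext)
    fix n
    show "fps_nth (qinf q u) n = fps_nth (fps_of_poly [:1, - u:] * qinf q (u * q)) n"
    proof (cases n)
      case (Suc k)
      have "1 - q ^ Suc k \<noteq> 0" using power_neq_one[OF assms, of k] by simp
      then have "c (Suc k) = c (Suc k) * q ^ Suc k - c k * q ^ k"
        by (simp add: c_def field_simps)
      then have "u ^ Suc k * c (Suc k) = u ^ Suc k * (c (Suc k) * q ^ Suc k - c k * q ^ k)"
        by simp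
      also have "\<dots> = (u * q) ^ Suc k * c (Suc k) - u * ((u * q) ^ k * c k)"
        by (simp add: algebra_simps)
      finally show ?thesis unfolding p Suc
        by (simp add: qinf_def c_def left_diff_distrib mult.assoc del: prod.lessThan_Suc power_Suc)
    qed (simp add: p qinf_def left_diff_distrib)
  qed
qed

lemma qinf_qpoly:
  assumes "norm q < 1"
  shows "qinf q u = fps_of_poly (qpoly q u N) * qinf q (u * q ^ N)"
proof (induction N)
  case (Suc N)
  show ?case
    unfolding Suc qinf_rec[OF assms, of "u * q ^ N"]
    by (simp add: qpoly_def fps_of_poly_mult mult_ac)
qed (simp add: qpoly_def)

text \<open>
  The quotient formula \<open>(u x; q)\<^sub>n = (u x; q)\<^sub>\<infinity> / (u q\<^bsup>n\<^esup> x; q)\<^sub>\<infinity>\<close> for an integer \<open>n\<close>, without denominators: one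
  of the two polynomials is always \<open>1\<close>.
\<close>

lemma qinf_int_shift:
  assumes "norm q < 1" "q \<noteq> 0"
  shows "fps_of_poly (qpoly q u (nat n)) * qinf q (u * q powi n)
       = fps_of_poly (qpoly q (u * q powi n) (nat (- n))) * qinf q u"
proof (cases "0 \<le> n")
  case True
  then obtain N where "n = int N" using nonneg_int_cases by blast
  then show ?thesis using qinf_qpoly[OF assms(1), of u N] by (simp add: qpoly_def)
next
  case False
  then obtain N where N: "n = - int N" by (metis int_cases2 of_nat_0_le_iff)
  have u: "u * q powi n * q ^ N = u"
    using assms(2) N by (simp add: power_int_minus)
  have "qinf q (u * q powi n) = fps_of_poly (qpoly q (u * q powi n) N) * qinf q u"
    using qinf_qpoly[OF assms(1), of "u * q powi n" N] unfolding u .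
  then show ?thesis using N by (simp add: qpoly_def)
qed

lemma qinf_scale: "qinf q (u * c) = fps_compose (qinf q u) (fps_const c * fps_X)"
  unfolding fps_compose_linear by (rule fps_ext) (simp add: qinf_def power_mult_distrib mult_ac)

lemma qfact_eq_qpoly:
  assumes "q \<noteq> 0"
  shows "qfact q (u * x) n = poly (qpoly q u (nat n)) x / poly (qpoly q (u * q powi n) (nat (- n))) x"
proof (cases "0 \<le> n")
  case True
  then obtain N where "n = int N" using nonneg_int_cases by blast
  then show ?thesis by (simp add: qpoly_def qfact_int poly_prod mult_ac)
next
  case False
  then obtain N where N: "n = - int N" by (metis int_cases2 of_nat_0_le_iff)
  have "(\<Prod>k=1..N. 1 - u * x * q powi (- int k)) = (\<Prod>k<N. 1 - u * x * q powi (int k - int N))"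
    by (rule prod.reindex_bij_witness[of _ "\<lambda>k. N - k" "\<lambda>k. N - k"]) (auto simp: of_nat_diff)
  also have "\<dots> = poly (qpoly q (u * q powi n) N) x"
    using assms N by (simp add: qpoly_def poly_prod power_int_diff power_int_minus divide_inverse mult_ac)
  finally show ?thesis
    using N by (simp only: qfact_neg prod_dividef) (simp add: qpoly_def)
qed

text \<open>
  The only place where \<open>j\<close> enters an infinite product is as the factor \<open>q\<^bsup>j\<^esup>\<close> of the variable, so the series
  \<open>F\<close> of the rational function factors as a fixed series times a fixed series in \<open>q\<^bsup>j\<^esup> x\<close>.
  Denominator exponents \<open>N i + j\<close> may be negative, in which case the factor moves to the numerator.
\<close>

lemma shifted_product_fps:
  fixes u :: "'l \<Rightarrow> complex" and v :: "'i \<Rightarrow> complex"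
  assumes q: "norm q < 1" "q \<noteq> 0" and fin: "finite L" "finite I"
  shows "\<exists>G H. \<forall>j F. (\<forall>l\<in>L. 0 \<le> M l + j) \<longrightarrow>
       F * fps_of_poly (\<Prod>i\<in>I. qpoly q (v i) (nat (N i + j)))
         = fps_of_poly ((\<Prod>l\<in>L. qpoly q (u l) (nat (M l + j)))
             * (\<Prod>i\<in>I. qpoly q (v i * q powi (N i + j)) (nat (- (N i + j))))) \<longrightarrow>
       F = G * fps_compose H (fps_const (q powi j) * fps_X)"
proof (intro exI allI impI)
  fix j F
  define c where "c = fps_const (q powi j) * (fps_X :: complex fps)"
  define A where "A = (\<Prod>i\<in>I. qinf q (v i))"
  define B where "B = (\<Prod>l\<in>L. qinf q (u l))"
  define A' where "A' = (\<Prod>i\<in>I. qinf q (v i * q powi N i))"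
  define B' where "B' = (\<Prod>l\<in>L. qinf q (u l * q powi M l))"
  assume nonneg: "\<forall>l\<in>L. 0 \<le> M l + j"
  assume F: "F * fps_of_poly (\<Prod>i\<in>I. qpoly q (v i) (nat (N i + j)))
         = fps_of_poly ((\<Prod>l\<in>L. qpoly q (u l) (nat (M l + j)))
             * (\<Prod>i\<in>I. qpoly q (v i * q powi (N i + j)) (nat (- (N i + j)))))"
  have c0: "fps_nth c 0 = 0" by (simp add: c_def)
  have sc: "fps_compose (qinf q (w * q powi k)) c = qinf q (w * q powi (k + j))" for w k
    using q unfolding c_def qinf_scale[symmetric] by (simp add: power_int_add mult.assoc)
  have Ac: "fps_compose A' c = (\<Prod>i\<in>I. qinf q (v i * q powi (N i + j)))"
    by (simp only: A'_def fps_compose_prod_distrib[OF c0] sc)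
  have Bc: "fps_compose B' c = (\<Prod>l\<in>L. qinf q (u l * q powi (M l + j)))"
    by (simp only: B'_def fps_compose_prod_distrib[OF c0] sc)
  have prod_const_L: "fps_nth (\<Prod>i\<in>S. f i) 0 = (\<Prod>i\<in>S. fps_nth (f i) 0)" for S and f :: "'l \<Rightarrow> complex fps"
    by (induction S rule: infinite_finite_induct) auto
  have prod_const_I: "fps_nth (\<Prod>i\<in>S. f i) 0 = (\<Prod>i\<in>S. fps_nth (f i) 0)" for S and f :: "'i \<Rightarrow> complex fps"
    by (induction S rule: infinite_finite_induct) auto
  have A0: "fps_nth A 0 \<noteq> 0" and B0: "fps_nth B' 0 \<noteq> 0"
    by (simp_all add: A_def B'_def prod_const_L prod_const_I)
  define D where "D = fps_of_poly (\<Prod>i\<in>I. qpoly q (v i) (nat (N i + j)))"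
  define Num1 where "Num1 = fps_of_poly (\<Prod>l\<in>L. qpoly q (u l) (nat (M l + j)))"
  define Num2 where "Num2 = fps_of_poly (\<Prod>i\<in>I. qpoly q (v i * q powi (N i + j)) (nat (- (N i + j))))"
  have 1: "D * fps_compose A' c = Num2 * A"
    unfolding D_def Num2_def A_def Ac fps_of_poly_prod prod.distrib[symmetric]
    by (intro prod.cong qinf_int_shift q refl)
  have 2: "Num1 * fps_compose B' c = B"
    unfolding Num1_def B_def Bc fps_of_poly_prod prod.distrib[symmetric]
  proof (rule prod.cong)
    fix l assume "l \<in> L"
    then have "0 \<le> M l + j" using nonneg by blast
    then have "nat (- (M l + j)) = 0" by simp
    then show "fps_of_poly (qpoly q (u l) (nat (M l + j))) * qinf q (u l * q powi (M l + j)) = qinf q (u l)"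
      using qinf_int_shift[OF q, of "u l" "M l + j"] by (simp add: qpoly_def)
  qed simp
  have D0: "D \<noteq> 0"
  proof -
    have "qpoly q w n \<noteq> 0" for w n by (simp add: qpoly_def)
    then show ?thesis using fin by (simp add: D_def)
  qed
  have FN: "F * D = Num1 * Num2" using F by (simp add: D_def Num1_def Num2_def fps_of_poly_mult)
  \<comment> \<open>infinite products are cleared first, then the polynomial denominator \<open>D\<close> is cancelled\<close>
  have "D * (F * A * fps_compose B' c) = (F * D) * A * fps_compose B' c" by (simp only: mult_ac)
  also have "\<dots> = (Num1 * fps_compose B' c) * (Num2 * A)"
    unfolding FN by (simp only: mult_ac)
  also have "\<dots> = D * (B * fps_compose A' c)"
    unfolding 2 1[symmetric] by (simp only: mult_ac)
  finally have 3: "F * A * fps_compose B' c = B * fps_compose A' c" using D0 by simp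
  have inv: "inverse A * A = 1" "inverse B' * B' = 1"
    using A0 B0 by (auto intro: inverse_mult_eq_1)
  have invc: "fps_compose (inverse B') c * fps_compose B' c = 1"
    by (simp only: fps_compose_mult_distrib[OF c0, symmetric] inv fps_compose_1)
  have "F = (inverse A * A) * (fps_compose (inverse B') c * fps_compose B' c) * F"
    by (simp only: inv invc mult_1_left)
  also have "\<dots> = inverse A * fps_compose (inverse B') c * (F * A * fps_compose B' c)"
    by (simp only: mult_ac)
  also have "\<dots> = (inverse A * B) * fps_compose (A' * inverse B') c"
    unfolding 3 fps_compose_mult_distrib[OF c0] by (simp only: mult_ac)
  finally show "F = (inverse (\<Prod>i\<in>I. qinf q (v i)) * (\<Prod>l\<in>L. qinf q (u l)))
      * fps_compose ((\<Prod>i\<in>I. qinf q (v i * q powi N i)) * inverse (\<Prod>l\<in>L. qinf q (u l * q powi M l)))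
           (fps_const (q powi j) * fps_X)"
    unfolding A_def A'_def B_def B'_def c_def .
qed

section \<open>The finite \<open>q\<close>-binomial theorem\<close>

lemma qfact_self_nonzero: "norm q < 1 \<Longrightarrow> qfact q q (int n) \<noteq> 0"
  using power_neq_one[of q] by (simp add: qfact_int)

lemma qbinomial_int:
  "qbinomial q (int n) (int c) = (if c \<le> n then qfact q q (int n) / (qfact q q (int c) * qfact q q (int (n - c))) else 0)"
  by (auto simp: qbinomial_def of_nat_diff)

lemma qbinomial_pascal:
  assumes "norm q < 1"
  shows "qbinomial q (int (Suc n)) (int (Suc c))
     = qbinomial q (int n) (int (Suc c)) + (if c \<le> n then q ^ (n - c) * qbinomial q (int n) (int c) else 0)"
proof -
  have S: "qfact q q (int (Suc k)) = qfact q q (int k) * (1 - q ^ Suc k)" for k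
    by (simp only: qfact_int_Suc power_Suc)
  have nz: "1 - q ^ Suc k \<noteq> 0" "qfact q q (int k) \<noteq> 0" for k
    using power_neq_one[OF assms, of k] qfact_self_nonzero[OF assms, of k] by auto
  consider "n < c" | "c = n" | d where "n = Suc (c + d)"
    by (metis less_imp_Suc_add linorder_neqE_nat)
  then show ?thesis
  proof cases
    case 3
    have "n - c = Suc d" "n - Suc c = d" "Suc n - Suc c = Suc d" "Suc c \<le> n" "c \<le> n" "Suc c \<le> Suc n"
      using 3 by auto
    moreover have "q ^ Suc n = q ^ Suc d * q ^ Suc c" using 3 by (simp add: power_add)
    ultimately show ?thesis using nz[of c] nz[of d] nz[of n]
      unfolding qbinomial_int by (simp only: S if_True) (simp add: divide_simps del: power_Suc, simp add: algebra_simps del: power_Suc)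
  qed (use nz in \<open>auto simp: qbinomial_int simp del: of_nat_Suc\<close>)
qed

text \<open>
  Gauss's formula, by induction on \<open>n\<close> from the Pascal rule.
\<close>

lemma q_binomial_theorem:
  assumes "norm q < 1"
  shows "qfact q z (int n) = (\<Sum>c\<le>n. qbinomial q (int n) (int c) * qsign q c * z ^ c)"
proof (induction n)
  case 0
  show ?case by (simp add: qbinomial_def)
next
  case (Suc n)
  define w where "w n c = qbinomial q (int n) (int c) * qsign q c" for n c
  have w0: "w k 0 = 1" for k
    using qfact_self_nonzero[OF assms, of k] by (simp add: w_def qbinomial_def)
  have wS: "w (Suc n) (Suc c) = w n (Suc c) - q ^ n * w n c" if "c \<le> n" for c
  proof -
    have "q ^ n = q ^ (n - c) * q ^ c" using that by (simp flip: power_add)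
    then show ?thesis using that unfolding w_def qbinomial_pascal[OF assms] qsign_Suc
      by (simp add: algebra_simps del: of_nat_Suc)
  qed
  have "(\<Sum>c\<le>Suc n. w (Suc n) c * z ^ c) = 1 + (\<Sum>c\<le>n. w (Suc n) (Suc c) * z ^ Suc c)"
    by (subst sum.atMost_Suc_shift) (simp add: w0)
  also have "\<dots> = 1 + (\<Sum>c\<le>n. w n (Suc c) * z ^ Suc c) - z * q ^ n * (\<Sum>c\<le>n. w n c * z ^ c)"
    by (simp add: wS sum_distrib_left algebra_simps sum_subtractf)
  also have "1 + (\<Sum>c\<le>n. w n (Suc c) * z ^ Suc c) = (\<Sum>c\<le>Suc n. w n c * z ^ c)"
    by (subst sum.atMost_Suc_shift) (simp add: w0)
  also have "\<dots> = (\<Sum>c\<le>n. w n c * z ^ c)"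
    by (simp add: w_def qbinomial_int del: of_nat_Suc)
  finally show ?case unfolding w_def[symmetric] qfact_int_Suc Suc by (simp add: algebra_simps)
qed

text \<open>
  The sum is \<open>(q\<^bsup>-e\<^esup>; q)\<^sub>n\<close>, which contains the factor \<open>1 - q\<^bsup>-e\<^esup> q\<^bsup>e\<^esup>\<close>.
\<close>

lemma q_binomial_annihilates:
  assumes "norm q < 1" "q \<noteq> 0" "e < n"
  shows "(\<Sum>c\<le>n. qbinomial q (int n) (int c) * qsign q c * (q powi (- int c)) ^ e) = 0"
proof -
  have "(q powi (- int c)) ^ e = (inverse (q ^ e)) ^ c" for c
    by (simp add: power_int_minus mult.commute flip: power_mult power_inverse)
  then have "(\<Sum>c\<le>n. qbinomial q (int n) (int c) * qsign q c * (q powi (- int c)) ^ e)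
      = qfact q (inverse (q ^ e)) (int n)"
    by (simp add: q_binomial_theorem[OF assms(1)])
  also have "\<dots> = 0"
    unfolding qfact_int by (rule prod_zero, simp, rule bexI[of _ e]) (use assms in auto)
  finally show ?thesis .
qed

section \<open>The coefficients of the product as residues\<close>

lemma prod_scaled:
  fixes f g y :: "'l \<Rightarrow> complex"
  assumes "\<And>l. l \<in> A \<Longrightarrow> f l = y l ^ h / c * g l"
  shows "(\<Prod>l\<in>A. f l) = (\<Prod>l\<in>A. y l) ^ h / c ^ card A * (\<Prod>l\<in>A. g l)"
proof -
  have "(\<Prod>l\<in>A. f l) = (\<Prod>l\<in>A. y l ^ h / c * g l)"
    using assms by (intro prod.cong) auto
  then show ?thesis by (simp add: prod.distrib prod_dividef prod_power_distrib)
qed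

text \<open>
  Relative to the pole \<open>X\<^sub>i q\<^bsup>-h\<^esup>\<close>, the other poles in the same chain \<open>X\<^sub>i q\<^bsup>-k\<^esup>\<close>, \<open>k \<le> h + L\<close>, contribute this
  product to the residue.
\<close>

lemma root_product_omitting_self:
  assumes "q \<noteq> 0"
  shows "(\<Prod>k\<in>{..<h + L + 1} - {h}. 1 - q powi (int k - int h))
     = (1 / q) ^ h / qsign q h * (qfact q q (int h) * qfact q q (int L))"
proof -
  have split: "{..<h + L + 1} - {h} = {..<h} \<union> {Suc h..<Suc h + L}" by auto
  have "(\<Prod>k\<in>{..<h + L + 1} - {h}. 1 - q powi (int k - int h))
      = (\<Prod>k<h. 1 - q powi (int k - int h)) * (\<Prod>k=Suc h..<Suc h + L. 1 - q powi (int k - int h))"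
    unfolding split by (rule prod.union_disjoint) auto
  also have "(\<Prod>k=Suc h..<Suc h + L. 1 - q powi (int k - int h)) = (\<Prod>k<L. 1 - q powi int (Suc k))"
  proof (subst prod.atLeastLessThan_shift_0, rule prod.cong)
    show "{0..<Suc h + L - Suc h} = {..<L}" by (simp add: atLeast0LessThan)
    fix k
    have "int (Suc h + k) - int h = int (Suc k)" by simp
    then show "((\<lambda>k. 1 - q powi (int k - int h)) \<circ> plus (Suc h)) k = 1 - q powi int (Suc k)"
      by (simp only: o_def)
  qed
  also have "\<dots> = qfact q q (int L)"
    by (simp only: qfact_int power_int_of_nat power_Suc)
  also have "(\<Prod>k<h. 1 - q powi (int k - int h)) = qfact q (1 / q * q powi (1 - int h)) (int h)"
  proof -
    have "q powi (int k - int h) = 1 / q * q powi (1 - int h) * q ^ k" for k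
      using assms by (simp add: power_int_diff)
    then show ?thesis by (simp only: qfact_int)
  qed
  also have "\<dots> = (1 / q) ^ h * qfact q q (int h) / qsign q h"
    using qfact_reverse[OF assms, of "1 / q" h] assms by simp
  finally show ?thesis by (simp only: times_divide_eq_left times_divide_eq_right mult.assoc)
qed

text \<open>
  The numbers \<open>X i\<close> and \<open>B l\<close> are \<open>q\<^bsup>a\<^sub>i\<^esup>\<close> and \<open>q\<^bsup>b\<^sub>l\<^esup>\<close>. The assumption \<open>generic\<close> says that the pole chains
  \<open>X\<^sub>i q\<^bsup>-h\<^esup>\<close> for different \<open>i\<close> are disjoint, so all poles are simple (as \<open>\<bar>q\<bar> < 1\<close>) and no shifted factorial in a
  denominator vanishes; \<open>numerator\<close> says that the numerators on the left are defined.
\<close>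

locale qhyp_data =
  fixes q :: complex and r s :: nat and X B :: "nat \<Rightarrow> complex"
    and m n :: "nat \<Rightarrow> int" and t :: int
  assumes q0: "q \<noteq> 0" and q1: "norm q < 1" and sr: "s < r"
    and X0: "X i \<noteq> 0" and B0: "B l \<noteq> 0"
    and generic: "i \<in> {1..r} \<Longrightarrow> l \<in> {1..r} - {i} \<Longrightarrow> X i / X l \<noteq> q powi k"
    and numerator: "i \<in> {1..r} \<Longrightarrow> l \<in> {1..s} \<Longrightarrow> qfact_defined q (q * X i / B l) (m l - n i)"
begin

definition W :: complex where
  "W = q powi (t + int r - 1) * (\<Prod>i=1..r. X i) / (\<Prod>l=1..s. B l)"

text \<open>
  The contribution to the coefficient of \<open>z\<^bsup>j\<^esup>\<close> on the left that comes from the \<open>i\<close>-th summand and the \<open>h\<close>-th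
  term of its first series. The residues and the terms of \<open>beta_term\<close> are rearrangements of this form.
\<close>

definition \<kappa> :: "nat \<Rightarrow> nat \<Rightarrow> int \<Rightarrow> complex" where
  "\<kappa> i h j =
     X i powi (1 - t)
     * (\<Prod>l=1..s. qfact q (B l / X i) (int h) * qfact q (q * X i / B l) (m l + j - int h))
     / ((\<Prod>l\<in>{1..r} - {i}. qfact q (q * X l / X i) (int h) * qfact q (X i / X l) (n l + j + 1 - int h))
        * (qfact q q (int h) * qfact q q (n i + j - int h)))
     * qsign q h ^ (r - s) * (W * X i powi (int s - int r)) ^ h"

definition \<alpha> :: "int \<Rightarrow> complex" where
  "\<alpha> j = (\<Sum>i=1..r. \<Sum>h<nat (n i + j + 1). \<kappa> i h j)"

lemma generic_defined:
  assumes "i \<in> {1..r}" "l \<in> {1..r} - {i}"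
  shows "qfact_defined q (X i / X l) k"
  unfolding qfact_defined_def
proof (intro allI impI)
  fix k :: nat
  have "X i / X l \<noteq> q powi int k" using generic[OF assms] by blast
  then show "1 - X i / X l * q powi - int k \<noteq> 0"
    using q0 X0[of l] by (simp add: power_int_minus field_simps)
qed

text \<open>
  For a negative index the convention \<open>1 / 0 = 0\<close> makes \<open>qfact\<close> vanish where it is undefined; \<open>generic\<close> excludes
  this as well.
\<close>

lemma generic_nonzero:
  assumes "i \<in> {1..r}" "l \<in> {1..r} - {i}"
  shows "qfact q (X i / X l * q powi c) k \<noteq> 0"
proof -
  have "1 - X i / X l * q powi c * q powi d \<noteq> 0" for d
  proof
    assume "1 - X i / X l * q powi c * q powi d = 0"
    then have "X i / X l * q powi (c + d) = 1"
      using q0 by (simp only: power_int_add mult.assoc simp_thms) simp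
    then have "X i / X l = q powi (- (c + d))"
      using q0 X0[of l] by (simp add: power_int_minus field_simps del: minus_add_distrib)
    then show False using generic[OF assms] by blast
  qed
  then have "1 - X i / X l * q powi c * q powi d \<noteq> 0" "1 - X i / X l * q powi c * q ^ e \<noteq> 0" for d e
    by (auto simp flip: power_int_of_nat)
  then show ?thesis by (auto simp: qfact_def)
qed

lemma numerator_defined:
  assumes "i \<in> {1..r}" "l \<in> {1..s}" "int h \<le> n i + j"
  shows "qfact_defined q (q * X i / B l) (m l + j - int h)"
  using qfact_defined_mono[OF numerator[OF assms(1,2)]] assms(3) by simp

lemma W_eq:
  assumes "i \<in> {1..r}"
  shows "q powi (t + int r - 1) * (\<Prod>l=1..s. X i / B l) / (\<Prod>l\<in>{1..r} - {i}. X i / X l)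
       = W * X i powi (int s - int r)"
proof -
  have "(\<Prod>l=1..r. X l) = X i * (\<Prod>l\<in>{1..r} - {i}. X l)"
    using assms by (intro prod.remove) auto
  moreover have "(\<Prod>l\<in>{1..r} - {i}. X l) \<noteq> 0" "(\<Prod>l=1..s. B l) \<noteq> 0" using X0 B0 by auto
  moreover have "card ({1..r} - {i}) = r - 1" using assms by simp
  moreover have "X i ^ r = X i * X i ^ (r - 1)" using assms by (cases r) auto
  ultimately show ?thesis
    using X0[of i] by (simp add: W_def prod_dividef power_int_diff field_simps)
qed

text \<open>
  The right-hand side is minus the residue at \<open>\<rho>\<close> of \<open>x\<^bsup>-t\<^esup> (\<Prod>l. (q x / B\<^sub>l; q)\<^bsub>m\<^sub>l + j\<^esub>) / (\<Prod>i. (x / X\<^sub>i; q)\<^bsub>n\<^sub>i + j + 1\<^esub>)\<close>.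
  Each factor is split at \<open>h\<close> and its first part is reversed. There are \<open>s\<close> numerator factors and \<open>r\<close> denominator
  factors, the latter including the chain of \<open>\<rho>\<close> itself, and each leaves one power of \<open>qsign q h\<close>: this is how the exponent
  \<open>r - s\<close> of the series \<open>qhyp\<close> arises.
\<close>

lemma \<kappa>_residue:
  assumes i: "i \<in> {1..r}" and h: "int h \<le> n i + j"
  defines "\<rho> \<equiv> X i * q powi (- int h)"
  shows "\<kappa> i h j = \<rho> powi (1 - t) * (\<Prod>l=1..s. qfact q (q / B l * \<rho>) (m l + j))
     / ((\<Prod>l\<in>{1..r} - {i}. qfact q (1 / X l * \<rho>) (n l + j + 1))
        * (\<Prod>k\<in>{..<nat (n i + j + 1)} - {h}. 1 - q powi (int k - int h)))"
proof -
  define sg where "sg = qsign q h"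
  have sg0: "sg \<noteq> 0" using q0 by (simp add: sg_def qsign_nonzero)
  have num: "qfact q (q / B l * \<rho>) (m l + j) = (X i / B l) ^ h / sg
      * (qfact q (B l / X i) (int h) * qfact q (q * X i / B l) (m l + j - int h))" if "l \<in> {1..s}" for l
  proof -
    have e1: "q / B l * \<rho> = q * X i / B l * q powi (- int h)" by (simp add: \<rho>_def)
    have e2: "q * X i / B l * q powi (- int h) = X i / B l * q powi (1 - int h)"
      using q0 by (simp add: power_int_diff power_int_minus divide_inverse)
    have rev: "qfact q (X i / B l * q powi (1 - int h)) (int h)
        = (X i / B l) ^ h * qfact q (B l / X i) (int h) / sg"
      using qfact_reverse[OF q0, of "X i / B l" h] X0 B0 by (simp add: sg_def)
    show ?thesis
      unfolding e1 qfact_shift[OF q0 numerator_defined[OF i that h]] unfolding e2 rev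
      by (simp add: mult_ac)
  qed
  have den: "qfact q (1 / X l * \<rho>) (n l + j + 1) = (X i / X l / q) ^ h / sg
      * (qfact q (q * X l / X i) (int h) * qfact q (X i / X l) (n l + j + 1 - int h))"
    if "l \<in> {1..r} - {i}" for l
  proof -
    have e1: "1 / X l * \<rho> = X i / X l * q powi (- int h)" by (simp add: \<rho>_def)
    have e2: "X i / X l * q powi (- int h) = X i / X l / q * q powi (1 - int h)"
      using q0 by (simp add: power_int_diff power_int_minus divide_inverse)
    have rev: "qfact q (X i / X l / q * q powi (1 - int h)) (int h)
        = (X i / X l / q) ^ h * qfact q (q * X l / X i) (int h) / sg"
    proof -
      have inv: "1 / (X i / X l / q) = q * X l / X i" by (simp add: divide_inverse mult_ac)
      have "X i / X l / q \<noteq> 0" using X0 q0 by simp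
      from qfact_reverse[OF q0 this, of h] show ?thesis unfolding inv sg_def .
    qed
    show ?thesis
      unfolding e1 qfact_shift[OF q0 generic_defined[OF i that], of h "n l + j + 1"] unfolding e2 rev
      by (simp add: mult_ac)
  qed
  have self: "(\<Prod>k\<in>{..<nat (n i + j + 1)} - {h}. 1 - q powi (int k - int h))
     = (1 / q) ^ h / sg * (qfact q q (int h) * qfact q q (n i + j - int h))"
  proof -
    obtain L where L: "n i + j = int h + int L" using h zle_iff_zadd by auto
    then have "nat (n i + j + 1) = h + L + 1" "n i + j - int h = int L" by auto
    then show ?thesis using root_product_omitting_self[OF q0, of h L] by (simp only: sg_def)
  qed
  have numP: "(\<Prod>l=1..s. qfact q (q / B l * \<rho>) (m l + j)) = (\<Prod>l=1..s. X i / B l) ^ h / sg ^ s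
      * (\<Prod>l=1..s. qfact q (B l / X i) (int h) * qfact q (q * X i / B l) (m l + j - int h))"
    by (subst prod_scaled, erule num) simp
  have denP: "(\<Prod>l\<in>{1..r} - {i}. qfact q (1 / X l * \<rho>) (n l + j + 1))
      = (\<Prod>l\<in>{1..r} - {i}. X i / X l / q) ^ h / sg ^ (r - 1)
      * (\<Prod>l\<in>{1..r} - {i}. qfact q (q * X l / X i) (int h) * qfact q (X i / X l) (n l + j + 1 - int h))"
    by (subst prod_scaled, erule den) (use i in simp)
  have card_r: "card ({1..r} - {i}) = r - 1" using i by simp
  have "(\<Prod>l\<in>{1..r} - {i}. X i / X l / q) = (\<Prod>l\<in>{1..r} - {i}. X i / X l) / q ^ (r - 1)"
    unfolding prod_dividef[of "\<lambda>l. X i / X l" "\<lambda>_. q"] using i by (simp only: prod_constant card_r)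
  moreover have "q powi (t + int r - 1) = q powi (t - 1) * q ^ (r - 1) * q"
  proof -
    have "t + int r - 1 = (t - 1) + int (r - 1) + 1" using i by (simp add: of_nat_diff)
    then show ?thesis using q0 by (simp only: power_int_add power_int_of_nat power_int_1_right simp_thms)
  qed
  ultimately have key: "W * X i powi (int s - int r)
     = q powi (t - 1) * (\<Prod>l=1..s. X i / B l) / ((\<Prod>l\<in>{1..r} - {i}. X i / X l / q) * (1 / q))"
    unfolding W_eq[OF i, symmetric] using q0 by simp
  have sgr: "sg ^ (r - 1) * sg = sg ^ (r - s) * sg ^ s"
    using sr power_minus_mult[of r sg] power_add[of sg "r - s" s] by simp
  have rho: "\<rho> powi (1 - t) = X i powi (1 - t) * (q powi (t - 1)) ^ h"
  proof -
    have "(q powi (- int h)) powi (1 - t) = q powi (- int h * (1 - t))"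
      by (rule power_int_mult[symmetric])
    also have "- int h * (1 - t) = (t - 1) * int h" by (simp add: algebra_simps)
    also have "q powi ((t - 1) * int h) = (q powi (t - 1)) ^ h"
      by (simp only: power_int_mult power_int_of_nat)
    finally show ?thesis unfolding \<rho>_def power_int_mult_distrib by (simp only:)
  qed
  have alg: "xt * (qt * a / (b * c)) ^ h * (P1 / (P2 * P3)) * sg ^ (r - s)
     = xt * qt ^ h * (a ^ h / sg ^ s * P1) / ((b ^ h / sg ^ (r - 1) * P2) * (c ^ h / sg * P3))"
    for xt qt a b c P1 P2 P3 :: complex
  proof -
    have "xt * qt ^ h * (a ^ h / sg ^ s * P1) / ((b ^ h / sg ^ (r - 1) * P2) * (c ^ h / sg * P3))
       = xt * (qt ^ h * a ^ h / (b ^ h * c ^ h)) * (P1 / (P2 * P3)) * ((sg ^ (r - 1) * sg) / sg ^ s)"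
      by (simp add: divide_inverse mult_ac)
    also have "(sg ^ (r - 1) * sg) / sg ^ s = sg ^ (r - s)" unfolding sgr using sg0 by simp
    finally show ?thesis by (simp add: power_divide power_mult_distrib)
  qed
  have "\<kappa> i h j = X i powi (1 - t)
      * (q powi (t - 1) * (\<Prod>l=1..s. X i / B l) / ((\<Prod>l\<in>{1..r} - {i}. X i / X l / q) * (1 / q))) ^ h
      * ((\<Prod>l=1..s. qfact q (B l / X i) (int h) * qfact q (q * X i / B l) (m l + j - int h))
         / ((\<Prod>l\<in>{1..r} - {i}. qfact q (q * X l / X i) (int h) * qfact q (X i / X l) (n l + j + 1 - int h))
            * (qfact q q (int h) * qfact q q (n i + j - int h)))) * sg ^ (r - s)"
    unfolding \<kappa>_def key sg_def by (simp only: mult_ac times_divide_eq_right times_divide_eq_left)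
  then show ?thesis unfolding numP denP self rho alg .
qed

text \<open>
  The factorials of \<open>\<kappa>\<close> whose index contains \<open>- h\<close> are completed to the index at \<open>h = 0\<close>, at the cost of
  reversed factorials of length \<open>h\<close>, which are the new parameters of the terminating series. The powers created by the
  reversal turn \<open>W\<close> into the argument of that series.
\<close>

lemma \<kappa>_beta:
  assumes i: "i \<in> {1..r}" and h: "int h \<le> n i + j"
    and lower: "\<And>l. l \<in> {1..s} \<Longrightarrow> qfact q (B l / X i * q powi (- m l - j)) (int h) \<noteq> 0"
  shows "\<kappa> i h j =
     X i powi (1 - t) * (\<Prod>l=1..s. qfact q (q * X i / B l) (m l + j))
     / (qfact q q (n i + j) * (\<Prod>l\<in>{1..r} - {i}. qfact q (X i / X l) (n l + j + 1)))
     * (qfact q (q powi (- j - n i)) (int h) * ((\<Prod>l=1..s. qfact q (B l / X i) (int h))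
          * (\<Prod>l\<in>{1..r} - {i}. qfact q (X l / X i * q powi (- n l - j)) (int h)))
        / ((\<Prod>l=1..s. qfact q (B l / X i * q powi (- m l - j)) (int h))
          * (\<Prod>l\<in>{1..r} - {i}. qfact q (q * X l / X i) (int h)) * qfact q q (int h))
        * (q powi ((\<Sum>i=1..r. n i) - (\<Sum>l=1..s. m l) + int r - 1 + t + j * (int r - int s))) ^ h)"
proof -
  define sg where "sg = qsign q h"
  have sg0: "sg \<noteq> 0" using q0 by (simp add: sg_def qsign_nonzero)
  have split: "qfact q x (k + 1) = qfact q x (k + 1 - int h) *
       ((x * q powi k) ^ h * qfact q (1 / x * q powi (- k)) (int h) / sg)"
    if "qfact_defined q x (k + 1 - int h)" "x \<noteq> 0" for x k
  proof -
    have e: "x * q powi (k + 1 - int h) = x * q powi k * q powi (1 - int h)"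
      using q0 power_int_add[of q k "1 - int h"] by (simp add: algebra_simps)
    have inv: "1 / (x * q powi k) = 1 / x * q powi (- k)" by (simp add: power_int_minus divide_inverse)
    have "qfact q x (k + 1) = qfact q x (k + 1 - int h) * qfact q (x * q powi (k + 1 - int h)) (int h)"
      using qfact_add[OF q0 that(1), of h] by simp
    also have "qfact q (x * q powi (k + 1 - int h)) (int h)
        = (x * q powi k) ^ h * qfact q (1 / x * q powi (- k)) (int h) / sg"
      unfolding e inv[symmetric] sg_def using q0 that(2) by (intro qfact_reverse) auto
    finally show ?thesis .
  qed
  have num: "qfact q (q * X i / B l) (m l + j) * qfact q (B l / X i) (int h)
        / qfact q (B l / X i * q powi (- m l - j)) (int h)
      = (X i / B l * q powi (m l + j)) ^ h / sg
        * (qfact q (B l / X i) (int h) * qfact q (q * X i / B l) (m l + j - int h))" if l: "l \<in> {1..s}" for l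
  proof -
    have "qfact_defined q (q * X i / B l) (m l + j - 1 + 1 - int h)"
      using numerator_defined[OF i l h] by simp
    from split[OF this] X0 B0 q0
    have "qfact q (q * X i / B l) (m l + j) = qfact q (q * X i / B l) (m l + j - int h) *
       ((q * X i / B l * q powi (m l + j - 1)) ^ h * qfact q (1 / (q * X i / B l) * q powi (- (m l + j - 1))) (int h) / sg)"
      by simp
    also have "q * X i / B l * q powi (m l + j - 1) = X i / B l * q powi (m l + j)"
      using q0 by (simp add: power_int_diff)
    also have "1 / (q * X i / B l) * q powi (- (m l + j - 1)) = B l / X i * q powi (- m l - j)"
      using q0 X0 B0 by (simp add: power_int_minus power_int_diff power_int_add field_simps)
    finally show ?thesis using lower[OF l] by (simp add: mult_ac)
  qed
  have den: "qfact q (X i / X l) (n l + j + 1) * qfact q (q * X l / X i) (int h)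
        / qfact q (X l / X i * q powi (- n l - j)) (int h)
      = (X i / X l * q powi (n l + j)) ^ h / sg
        * (qfact q (q * X l / X i) (int h) * qfact q (X i / X l) (n l + j + 1 - int h))"
    if l: "l \<in> {1..r} - {i}" for l
  proof -
    have "qfact q (X l / X i * q powi (- n l - j)) (int h) \<noteq> 0"
      using l i by (intro generic_nonzero) auto
    moreover have "- (n l + j) = - n l - j" by simp
    ultimately show ?thesis
      using split[OF generic_defined[OF i l], of "n l + j"] X0 by (simp add: mult_ac)
  qed
  have self: "qfact q q (n i + j) * qfact q q (int h) / qfact q (q powi (- j - n i)) (int h)
      = (q powi (n i + j)) ^ h / sg * (qfact q q (int h) * qfact q q (n i + j - int h))"
  proof -
    obtain L where L: "n i + j = int L" using h by (metis nonneg_int_cases of_nat_0_le_iff order_trans)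
    have "qfact q (q powi (- j - n i)) (int h) \<noteq> 0"
    proof -
      have "1 - q powi (- int L) * q ^ k \<noteq> 0" if "k < h" for k
      proof
        assume "1 - q powi (- int L) * q ^ k = 0"
        then have "q ^ L = q ^ k" using q0 by (simp add: power_int_minus field_simps)
        moreover have "L = k + Suc (L - k - 1)" using that h L by simp
        ultimately have "q ^ k * q ^ Suc (L - k - 1) = q ^ k" by (metis power_add)
        then show False using q0 power_neq_one[OF q1] by simp
      qed
      moreover have "- j - n i = - int L" using L by simp
      ultimately show ?thesis by (simp add: qfact_int)
    qed
    moreover have "qfact_defined q q (n i + j - 1 + 1 - int h)"
      using h by (auto simp: qfact_defined_def)
    moreover have "q * q powi (n i + j - 1) = q powi (n i + j)"
      "1 / q * q powi (- (n i + j - 1)) = q powi (- j - n i)"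
      using q0 by (simp_all add: power_int_minus power_int_diff power_int_add field_simps)
    ultimately show ?thesis using split[of q "n i + j - 1"] q0 by (simp add: mult_ac)
  qed
  have numP: "(\<Prod>l=1..s. qfact q (q * X i / B l) (m l + j) * qfact q (B l / X i) (int h)
        / qfact q (B l / X i * q powi (- m l - j)) (int h))
      = (\<Prod>l=1..s. X i / B l * q powi (m l + j)) ^ h / sg ^ s
        * (\<Prod>l=1..s. qfact q (B l / X i) (int h) * qfact q (q * X i / B l) (m l + j - int h))"
    by (subst prod_scaled, erule num) simp
  have denP: "(\<Prod>l\<in>{1..r} - {i}. qfact q (X i / X l) (n l + j + 1) * qfact q (q * X l / X i) (int h)
        / qfact q (X l / X i * q powi (- n l - j)) (int h))
      = (\<Prod>l\<in>{1..r} - {i}. X i / X l * q powi (n l + j)) ^ h / sg ^ (r - 1)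
        * (\<Prod>l\<in>{1..r} - {i}. qfact q (q * X l / X i) (int h) * qfact q (X i / X l) (n l + j + 1 - int h))"
    by (subst prod_scaled, erule den) (use i in simp)
  define Z where "Z = q powi ((\<Sum>i=1..r. n i) - (\<Sum>l=1..s. m l) + int r - 1 + t + j * (int r - int s))"
  have pint: "(\<Prod>l\<in>A. q powi f l) = q powi (\<Sum>l\<in>A. f l)" if "finite A" for A and f :: "nat \<Rightarrow> int"
    using that by (induction A) (auto simp: power_int_add q0)
  have "W * X i powi (int s - int r)
     = Z * (\<Prod>l=1..s. X i / B l * q powi (m l + j))
        / ((\<Prod>l\<in>{1..r} - {i}. X i / X l * q powi (n l + j)) * q powi (n i + j))"
  proof -
    have "(\<Sum>l=1..r. n l + j) = (n i + j) + (\<Sum>l\<in>{1..r} - {i}. n l + j)"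
      using i by (intro sum.remove) auto
    then have "(\<Sum>l\<in>{1..r} - {i}. n l + j) + (n i + j) = (\<Sum>l=1..r. n l) + int r * j"
      by (simp add: sum.distrib)
    then have 1: "q powi (\<Sum>l\<in>{1..r} - {i}. n l + j) * q powi (n i + j) = q powi ((\<Sum>l=1..r. n l) + int r * j)"
      using q0 by (metis power_int_add)
    have 2: "Z * q powi (\<Sum>l=1..s. m l + j) = q powi (t + int r - 1) * q powi ((\<Sum>l=1..r. n l) + int r * j)"
      using q0 unfolding Z_def by (simp add: sum.distrib algebra_simps flip: power_int_add)
    have "Z * (PX * M) / (PY * E1 * E2) = T * PX / PY"
      if "Z * M = T * (E1 * E2)" "E1 * E2 \<noteq> 0" for PX M PY E1 E2 T
    proof -
      have "Z * (PX * M) / (PY * E1 * E2) = (Z * M) * PX / (PY * (E1 * E2))" by (simp add: mult_ac)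
      then show ?thesis using that by simp
    qed
    from this[OF 2[folded 1]] show ?thesis
      unfolding W_eq[OF i, symmetric] prod.distrib using q0 by (simp add: pint)
  qed
  then have key: "W * X i powi (int s - int r) = Z * a / (b * c)"
    if "a = (\<Prod>l=1..s. X i / B l * q powi (m l + j))"
       "b = (\<Prod>l\<in>{1..r} - {i}. X i / X l * q powi (n l + j))" "c = q powi (n i + j)" for a b c
    using that by simp
  have sgr: "sg ^ (r - 1) * sg = sg ^ (r - s) * sg ^ s"
    using sr power_minus_mult[of r sg] power_add[of sg "r - s" s] by simp
  have alg: "xt * P1 / (P2 * P3) * sg ^ (r - s) * (z * a / (b * c)) ^ h
     = xt * N1 / (E1 * E2) * (F1 * (N2 * F2) / (N3 * D1 * D2) * z ^ h)"
    if n: "N1 * N2 / N3 = a ^ h / sg ^ s * P1" and d: "E2 * D1 / F2 = b ^ h / sg ^ (r - 1) * P2"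
      and e: "E1 * D2 / F1 = c ^ h / sg * P3"
    for xt z a b c P1 P2 P3 N1 N2 N3 E1 E2 D1 D2 F1 F2 :: complex
  proof -
    have "xt * N1 / (E1 * E2) * (F1 * (N2 * F2) / (N3 * D1 * D2) * z ^ h)
        = xt * z ^ h * (N1 * N2 / N3) / ((E2 * D1 / F2) * (E1 * D2 / F1))"
      by (simp add: divide_inverse mult_ac)
    also have "\<dots> = xt * (z ^ h * a ^ h / (b ^ h * c ^ h)) * (P1 / (P2 * P3)) * ((sg ^ (r - 1) * sg) / sg ^ s)"
      unfolding n d e by (simp add: divide_inverse mult_ac)
    also have "(sg ^ (r - 1) * sg) / sg ^ s = sg ^ (r - s)" unfolding sgr using sg0 by simp
    finally show ?thesis by (simp add: power_divide power_mult_distrib mult_ac)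
  qed
  show ?thesis
    unfolding \<kappa>_def key[OF refl refl refl] sg_def[symmetric] Z_def[symmetric]
    by (rule alg) (use numP denP self in \<open>simp_all only: prod.distrib prod_dividef\<close>)
qed

end

section \<open>Vanishing of the high coefficients\<close>

context qhyp_data
begin

lemma power_inject: "q ^ h = q ^ k \<Longrightarrow> h = k"
proof (induction h k rule: linorder_wlog)
  case (le h k)
  show ?case
  proof (rule ccontr)
    assume "h \<noteq> k"
    then have "k = h + Suc (k - h - 1)" using le by simp
    then have "q ^ h * q ^ Suc (k - h - 1) = q ^ h * 1" using le by (metis mult_1_right power_add)
    then show False using q0 power_neq_one[OF q1] by simp
  qed
qed metis

text \<open>
  The pole \<open>X\<^sub>i q\<^bsup>-h\<^esup>\<close> is represented by the pair \<open>(i, h)\<close>. Chains with \<open>n i + 1 + j \<le> 0\<close> are empty, because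
  their factors stand in the numerator.
\<close>

definition poles :: "int \<Rightarrow> (nat \<times> nat) set" where
  "poles j = (SIGMA i:{1..r}. {..<nat (n i + 1 + j)})"

definition pole_inv :: "nat \<times> nat \<Rightarrow> complex" where
  "pole_inv p = 1 / X (fst p) * q ^ snd p"

text \<open>
  The factors of the second product are those with negative index \<open>n i + 1 + j\<close>; for the others \<open>nat\<close> makes the
  factor \<open>1\<close>.
\<close>

definition residue_numerator :: "int \<Rightarrow> complex poly" where
  "residue_numerator j = (\<Prod>l=1..s. qpoly q (q / B l) (nat (m l + j)))
     * (\<Prod>i=1..r. qpoly q (1 / X i * q powi (n i + 1 + j)) (nat (- (n i + 1 + j))))"

lemma finite_poles: "finite (poles j)"
  by (simp add: poles_def)

lemma card_poles: "card (poles j) = (\<Sum>i=1..r. nat (n i + 1 + j))"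
  by (simp add: poles_def)

lemma pole_inv_nonzero: "pole_inv p \<noteq> 0"
  using X0 q0 by (simp add: pole_inv_def)

lemma inj_on_pole_inv: "inj_on pole_inv (poles j)"
proof (rule inj_onI)
  fix p p' assume p: "p \<in> poles j" and p': "p' \<in> poles j" and eq: "pole_inv p = pole_inv p'"
  obtain i h where ih: "p = (i, h)" by force
  obtain l k where lk: "p' = (l, k)" by force
  have eq: "q ^ h / X i = q ^ k / X l" using eq by (simp add: pole_inv_def ih lk)
  then have "q ^ h * X l = q ^ k * X i" using X0[of i] X0[of l] by (simp add: field_simps)
  then have "X i / X l = q ^ h / q ^ k" using X0[of i] X0[of l] q0 by (simp add: field_simps)
  then have "X i / X l = q powi (int h - int k)" using q0 by (simp add: power_int_diff)
  then have "i = l" using generic[of i l] p p' ih lk by (force simp: poles_def)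
  then have "q ^ h = q ^ k" using eq X0[of i] by simp
  then show "p = p'" using power_inject \<open>i = l\<close> ih lk by simp
qed

lemma prod_poles: "(\<Prod>p\<in>poles j. [:1, - pole_inv p:]) = (\<Prod>i=1..r. qpoly q (1 / X i) (nat (n i + 1 + j)))"
  unfolding poles_def qpoly_def pole_inv_def
  by (subst prod.Sigma) (auto simp: case_prod_beta)

lemma degree_qpoly_le: "degree (qpoly q u N) \<le> N"
proof -
  have "degree (qpoly q u N) \<le> sum (degree \<circ> (\<lambda>k. [:1, - (u * q ^ k):])) {..<N}"
    unfolding qpoly_def by (rule degree_prod_sum_le) simp
  also have "\<dots> \<le> (\<Sum>k<N. 1)" by (intro sum_mono) simp
  finally show ?thesis by simp
qed

lemma degree_prod_qpoly_le:
  assumes "finite A"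
  shows "degree (\<Prod>l\<in>A. qpoly q (u l) (N l)) \<le> sum N A"
proof -
  have "degree (\<Prod>l\<in>A. qpoly q (u l) (N l)) \<le> sum (degree \<circ> (\<lambda>l. qpoly q (u l) (N l))) A"
    using assms by (rule degree_prod_sum_le)
  also have "\<dots> \<le> sum N A" by (intro sum_mono) (simp add: degree_qpoly_le)
  finally show ?thesis .
qed

text \<open>
  Since \<open>nat (- x) = nat x - x\<close>, the chains in the numerator and the poles combine to the degree of the quotient,
  which is linear in \<open>j\<close> with slope \<open>s - r\<close>.
\<close>

lemma degree_residue_numerator:
  assumes "\<And>l. l \<in> {1..s} \<Longrightarrow> 0 \<le> m l + j"
  shows "int (degree (residue_numerator j))
      \<le> int (card (poles j)) + (\<Sum>l=1..s. m l) - (\<Sum>i=1..r. n i) - int r - j * (int r - int s)"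
proof -
  have "degree (residue_numerator j) \<le> (\<Sum>l=1..s. nat (m l + j)) + (\<Sum>i=1..r. nat (- (n i + 1 + j)))"
    unfolding residue_numerator_def
    by (rule order_trans[OF degree_mult_le]) (intro add_mono degree_prod_qpoly_le; simp)
  then have "int (degree (residue_numerator j))
      \<le> (\<Sum>l=1..s. int (nat (m l + j))) + (\<Sum>i=1..r. int (nat (- (n i + 1 + j))))"
    by (simp only: of_nat_sum[symmetric] of_nat_add[symmetric] of_nat_le_iff)
  also have "(\<Sum>l=1..s. int (nat (m l + j))) = (\<Sum>l=1..s. m l + j)"
    using assms by (intro sum.cong) auto
  also have "(\<Sum>i=1..r. int (nat (- (n i + 1 + j)))) = (\<Sum>i=1..r. int (nat (n i + 1 + j)) - (n i + 1 + j))"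
    by (intro sum.cong) auto
  finally show ?thesis
    by (simp add: card_poles sum.distrib sum_subtractf algebra_simps)
qed

text \<open>
  The power \<open>\<rho>\<^bsup>1-t\<^esup>\<close> is split so that only nonnegative powers occur: for \<open>t \<le> 1\<close> it goes into the polynomial
  numerator, for \<open>t \<ge> 1\<close> into a power of the reciprocal of the pole.
\<close>

lemma \<kappa>_residue_poly:
  assumes p: "(i, h) \<in> poles j" and nonneg: "\<And>l. l \<in> {1..s} \<Longrightarrow> 0 \<le> m l + j"
  shows "\<kappa> i h j = poly (monom 1 (nat (1 - t)) * residue_numerator j) (1 / pole_inv (i, h))
      * pole_inv (i, h) ^ nat (t - 1) / (\<Prod>p\<in>poles j - {(i, h)}. 1 - pole_inv p / pole_inv (i, h))"
proof -
  define \<rho> where "\<rho> = X i * q powi (- int h)"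
  have i: "i \<in> {1..r}" and hn: "h < nat (n i + 1 + j)" using p by (auto simp: poles_def)
  have h: "int h \<le> n i + j" using hn by simp
  have rho: "1 / pole_inv (i, h) = \<rho>"
    by (simp add: pole_inv_def \<rho>_def power_int_minus divide_inverse)
  have pow: "\<rho> powi (1 - t) = \<rho> ^ nat (1 - t) * pole_inv (i, h) ^ nat (t - 1)"
  proof (cases "t \<le> 1")
    case True
    then show ?thesis by (simp add: power_int_def)
  next
    case False
    have "pole_inv (i, h) = inverse \<rho>" unfolding rho[symmetric] by (simp add: divide_inverse)
    then show ?thesis using False by (simp add: power_int_def)
  qed
  define Pos where "Pos l = poly (qpoly q (1 / X l) (nat (n l + 1 + j))) \<rho>" for l
  define Neg where "Neg l = poly (qpoly q (1 / X l * q powi (n l + 1 + j)) (nat (- (n l + 1 + j)))) \<rho>" for l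
  have "poles j - {(i, h)} = Pair i ` ({..<nat (n i + 1 + j)} - {h})
      \<union> (SIGMA l:{1..r} - {i}. {..<nat (n l + 1 + j)})"
    using i by (auto simp: poles_def)
  then have "(\<Prod>p\<in>poles j - {(i, h)}. 1 - pole_inv p / pole_inv (i, h))
      = (\<Prod>p\<in>Pair i ` ({..<nat (n i + 1 + j)} - {h}). 1 - pole_inv p / pole_inv (i, h))
       * (\<Prod>p\<in>(SIGMA l:{1..r} - {i}. {..<nat (n l + 1 + j)}). 1 - pole_inv p / pole_inv (i, h))"
    by (simp only:) (rule prod.union_disjoint; auto)
  also have "(\<Prod>p\<in>Pair i ` ({..<nat (n i + 1 + j)} - {h}). 1 - pole_inv p / pole_inv (i, h))
      = (\<Prod>k\<in>{..<nat (n i + j + 1)} - {h}. 1 - q powi (int k - int h))"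
    using X0 q0 by (subst prod.reindex)
      (auto simp: inj_on_def pole_inv_def power_int_diff add_ac intro!: prod.cong)
  also have "(\<Prod>p\<in>(SIGMA l:{1..r} - {i}. {..<nat (n l + 1 + j)}). 1 - pole_inv p / pole_inv (i, h))
      = (\<Prod>l\<in>{1..r} - {i}. \<Prod>k<nat (n l + 1 + j). 1 - pole_inv (l, k) / pole_inv (i, h))"
    by (subst prod.Sigma) (auto simp: case_prod_beta)
  also have "\<dots> = (\<Prod>l\<in>{1..r} - {i}. Pos l)"
  proof (rule prod.cong)
    fix l
    have "1 - pole_inv (l, k) / pole_inv (i, h) = 1 - 1 / X l * q ^ k * \<rho>" for k
      unfolding rho[symmetric] by (simp add: pole_inv_def)
    then show "(\<Prod>k<nat (n l + 1 + j). 1 - pole_inv (l, k) / pole_inv (i, h)) = Pos l"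
      by (simp add: Pos_def qpoly_def poly_prod mult_ac)
  qed simp
  finally have den: "(\<Prod>p\<in>poles j - {(i, h)}. 1 - pole_inv p / pole_inv (i, h))
     = (\<Prod>k\<in>{..<nat (n i + j + 1)} - {h}. 1 - q powi (int k - int h)) * (\<Prod>l\<in>{1..r} - {i}. Pos l)" .
  have "(\<Prod>l=1..r. Neg l) = Neg i * (\<Prod>l\<in>{1..r} - {i}. Neg l)"
    using i by (intro prod.remove) auto
  moreover have "Neg i = 1" using h by (simp add: Neg_def qpoly_def)
  moreover have "(\<Prod>l=1..s. poly (qpoly q (q / B l) (nat (m l + j))) \<rho>) = (\<Prod>l=1..s. qfact q (q / B l * \<rho>) (m l + j))"
  proof (rule prod.cong)
    fix l assume "l \<in> {1..s}"
    then have "nat (- (m l + j)) = 0" using nonneg[of l] by simp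
    then show "poly (qpoly q (q / B l) (nat (m l + j))) \<rho> = qfact q (q / B l * \<rho>) (m l + j)"
      unfolding qfact_eq_qpoly[OF q0] by (simp add: qpoly_def)
  qed simp
  ultimately have num: "poly (residue_numerator j) \<rho>
     = (\<Prod>l=1..s. qfact q (q / B l * \<rho>) (m l + j)) * (\<Prod>l\<in>{1..r} - {i}. Neg l)"
    by (simp only: residue_numerator_def poly_mult poly_prod Neg_def[symmetric] mult_1_left)
  have fac: "(\<Prod>l\<in>{1..r} - {i}. qfact q (1 / X l * \<rho>) (n l + j + 1))
     = (\<Prod>l\<in>{1..r} - {i}. Pos l) / (\<Prod>l\<in>{1..r} - {i}. Neg l)"
    unfolding prod_dividef[symmetric]
  proof (rule prod.cong)
    fix l
    have "n l + j + 1 = n l + 1 + j" by simp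
    then show "qfact q (1 / X l * \<rho>) (n l + j + 1) = Pos l / Neg l"
      by (simp only: qfact_eq_qpoly[OF q0] Pos_def Neg_def)
  qed simp
  show ?thesis
    unfolding \<kappa>_residue[OF i h, folded \<rho>_def] den rho poly_mult num fac pow
    by (simp add: poly_monom mult_ac)
qed

text \<open>
  Beyond the bounds on \<open>j\<close>, the sum of the residues is the coefficient of \<open>x\<^bsup>t-1\<^esup>\<close> in \<open>G(x) H(q\<^bsup>j\<^esup> x)\<close>, a polynomial in
  \<open>q\<^bsup>j\<^esup>\<close> of degree less than \<open>t\<close>. For \<open>t \<le> 0\<close> there is no pole at \<open>0\<close> and the sum is empty.
\<close>

lemma \<alpha>_polynomial:
  obtains g where "\<And>j. (\<And>l. l \<in> {1..s} \<Longrightarrow> 0 \<le> m l + j) \<Longrightarrow>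
      (\<Sum>l=1..s. m l) - (\<Sum>i=1..r. n i) - int r - t + 1 < j * (int r - int s) \<Longrightarrow>
      \<alpha> j = (\<Sum>e<nat t. g e * (q powi j) ^ e)"
proof -
  obtain G H where GH: "\<forall>j F. (\<forall>l\<in>{1..s}. 0 \<le> m l + j) \<longrightarrow>
       F * fps_of_poly (\<Prod>i=1..r. qpoly q (1 / X i) (nat (n i + 1 + j)))
         = fps_of_poly (residue_numerator j) \<longrightarrow>
       F = G * fps_compose H (fps_const (q powi j) * fps_X)"
    using shifted_product_fps[OF q1 q0 finite_atLeastAtMost[of 1 s] finite_atLeastAtMost[of 1 r],
      where M = m and N = "\<lambda>i. n i + 1" and u = "\<lambda>l. q / B l" and v = "\<lambda>i. 1 / X i"]
    unfolding residue_numerator_def by (elim exE)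
  define g where "g e = fps_nth G (nat t - 1 - e) * fps_nth H e" for e
  show thesis
  proof
    fix j
    assume nonneg: "\<And>l. l \<in> {1..s} \<Longrightarrow> 0 \<le> m l + j"
      and deg: "(\<Sum>l=1..s. m l) - (\<Sum>i=1..r. n i) - int r - t + 1 < j * (int r - int s)"
    define D where "D = fps_of_poly (\<Prod>p\<in>poles j. [:1, - pole_inv p:])"
    define F where "F = fps_of_poly (residue_numerator j) * inverse D"
    define e where "e = nat (t - 1)"
    define d where "d = nat (1 - t)"
    have "fps_nth D 0 = 1"
      by (simp add: D_def poly_prod flip: poly_0_coeff_0)
    then have FD: "F * D = fps_of_poly (residue_numerator j)"
      unfolding F_def by (simp add: mult.assoc inverse_mult_eq_1)
    then have FGH: "F = G * fps_compose H (fps_const (q powi j) * fps_X)"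
      using GH[rule_format, of j F] nonneg by (simp only: D_def prod_poles)
    have "(fps_X ^ d * F) * D = fps_of_poly (monom 1 d * residue_numerator j)"
      using FD by (simp add: fps_of_poly_mult fps_of_poly_monom' mult.assoc)
    moreover have "degree (monom 1 d * residue_numerator j) < card (poles j) + e"
    proof -
      have "degree (monom 1 d * residue_numerator j) \<le> d + degree (residue_numerator j)"
        by (metis degree_mult_le degree_monom_eq one_neq_zero)
      moreover have "int d - int e = 1 - t" by (simp add: d_def e_def)
      ultimately show ?thesis using degree_residue_numerator[OF nonneg] deg by linarith
    qed
    ultimately have "(\<Sum>p\<in>poles j. poly (monom 1 d * residue_numerator j) (1 / pole_inv p) * pole_inv p ^ e
        / (\<Prod>p'\<in>poles j - {p}. 1 - pole_inv p' / pole_inv p)) = fps_nth (fps_X ^ d * F) e"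
      unfolding D_def using finite_poles inj_on_pole_inv pole_inv_nonzero by (intro residue_sum) auto
    moreover have "\<alpha> j = (\<Sum>p\<in>poles j. \<kappa> (fst p) (snd p) j)"
      unfolding \<alpha>_def poles_def
      by (subst sum.Sigma) (auto simp: case_prod_beta add_ac)
    moreover have "\<dots> = (\<Sum>p\<in>poles j. poly (monom 1 d * residue_numerator j) (1 / pole_inv p) * pole_inv p ^ e
        / (\<Prod>p'\<in>poles j - {p}. 1 - pole_inv p' / pole_inv p))"
      unfolding d_def e_def 
    proof (rule sum.cong)
      fix p assume "p \<in> poles j"
      then have "(fst p, snd p) \<in> poles j" by simp
      from \<kappa>_residue_poly[OF this nonneg]
      show "\<kappa> (fst p) (snd p) j = poly (monom 1 (nat (1 - t)) * residue_numerator j) (1 / pole_inv p)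
          * pole_inv p ^ nat (t - 1) / (\<Prod>p'\<in>poles j - {p}. 1 - pole_inv p' / pole_inv p)"
        by simp
    qed simp
    ultimately have \<alpha>: "\<alpha> j = fps_nth (fps_X ^ d * F) e" by simp
    show "\<alpha> j = (\<Sum>e<nat t. g e * (q powi j) ^ e)"
    proof (cases "t \<le> 0")
      case True
      \<comment> \<open>the numerator then carries a positive power of \<open>x\<close>, so the constant coefficient is \<open>0\<close>\<close>
      then have "e = 0" "d > 0" by (auto simp: d_def e_def)
      then show ?thesis using True by (simp add: \<alpha>)
    next
      case False
      then have t: "nat t = Suc e" "d = 0" by (auto simp: d_def e_def)
      have "fps_nth F e = (\<Sum>k=0..e. ((q powi j) ^ k * fps_nth H k) * fps_nth G (e - k))"
        unfolding FGH fps_compose_linear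
        by (subst mult.commute) (simp only: fps_mult_nth fps_nth_Abs_fps)
      then show ?thesis
        by (simp add: \<alpha> t g_def atLeast0AtMost lessThan_Suc_atMost mult_ac)
    qed
  qed
qed

text \<open>
  The bounds are imposed at \<open>k - max 0 t\<close>, the smallest index that occurs in the convolution.
\<close>

lemma \<alpha>_convolution_vanishes:
  assumes nonneg: "\<And>l. l \<in> {1..s} \<Longrightarrow> 0 \<le> m l + (k - max 0 t)"
    and deg: "(\<Sum>l=1..s. m l) - (\<Sum>i=1..r. n i) - int r - t + 1 < (k - max 0 t) * (int r - int s)"
  shows "(\<Sum>c\<le>nat t. qbinomial q (int (nat t)) (int c) * qsign q c * \<alpha> (k - int c)) = 0"
proof -
  obtain g where g: "\<And>j. (\<And>l. l \<in> {1..s} \<Longrightarrow> 0 \<le> m l + j) \<Longrightarrow>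
      (\<Sum>l=1..s. m l) - (\<Sum>i=1..r. n i) - int r - t + 1 < j * (int r - int s) \<Longrightarrow>
      \<alpha> j = (\<Sum>e<nat t. g e * (q powi j) ^ e)"
    using \<alpha>_polynomial by blast
  have "\<alpha> (k - int c) = (\<Sum>e<nat t. g e * (q powi k) ^ e * (q powi (- int c)) ^ e)" if "c \<le> nat t" for c
  proof -
    have "(k - max 0 t) * (int r - int s) \<le> (k - int c) * (int r - int s)"
      using sr that by (intro mult_right_mono) auto
    then have "\<alpha> (k - int c) = (\<Sum>e<nat t. g e * (q powi (k - int c)) ^ e)"
      using deg nonneg that by (intro g) (force+)
    also have "q powi (k - int c) = q powi k * q powi (- int c)"
      using q0 power_int_add[of q k "- int c"] by simp
    finally show ?thesis by (simp add: power_mult_distrib mult.assoc)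
  qed
  then have "(\<Sum>c\<le>nat t. qbinomial q (int (nat t)) (int c) * qsign q c * \<alpha> (k - int c))
     = (\<Sum>c\<le>nat t. \<Sum>e<nat t. g e * (q powi k) ^ e
          * (qbinomial q (int (nat t)) (int c) * qsign q c * (q powi (- int c)) ^ e))"
    by (simp add: sum_distrib_left mult_ac)
  also have "\<dots> = (\<Sum>e<nat t. g e * (q powi k) ^ e
          * (\<Sum>c\<le>nat t. qbinomial q (int (nat t)) (int c) * qsign q c * (q powi (- int c)) ^ e))"
    by (subst sum.swap) (simp add: sum_distrib_left)
  also have "\<dots> = 0"
  proof (intro sum.neutral ballI)
    fix e assume "e \<in> {..<nat t}"
    then show "g e * (q powi k) ^ e
        * (\<Sum>c\<le>nat t. qbinomial q (int (nat t)) (int c) * qsign q c * (q powi (- int c)) ^ e) = 0"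
      using q_binomial_annihilates[OF q1 q0, of e "nat t"] by (simp only: lessThan_iff mult_zero_right)
  qed
  finally show ?thesis .
qed

end

section \<open>Multiplying the two series\<close>

text \<open>
  The ratio test in the form suited to hypergeometric terms, whose successive quotients converge.
\<close>

lemma summable_norm_ratio_limit:
  fixes f g :: "nat \<Rightarrow> complex"
  assumes step: "\<And>k. f (Suc k) = f k * g k" and lim: "g \<longlonglongrightarrow> L" and L: "norm L < 1"
  shows "summable (\<lambda>k. norm (f k))"
proof -
  obtain c where c: "norm L < c" "c < 1" using L dense by blast
  have "eventually (\<lambda>k. norm (g k) < c) sequentially"
    using tendsto_norm[OF lim] c(1) by (rule order_tendstoD)
  then obtain N where N: "\<And>k. k \<ge> N \<Longrightarrow> norm (g k) < c"
    by (auto simp: eventually_sequentially)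
  show ?thesis
  proof (rule summable_ratio_test[of c N])
    fix k assume "k \<ge> N"
    then have "norm (f k) * norm (g k) \<le> norm (f k) * c"
      using N[of k] by (intro mult_left_mono) auto
    then show "norm (norm (f (Suc k))) \<le> c * norm (norm (f k))"
      by (simp add: step norm_mult mult.commute)
  qed (rule c(2))
qed

lemma sums_shift_right:
  fixes f :: "nat \<Rightarrow> complex"
  assumes "f sums S"
  shows "(\<lambda>P. if d \<le> P then f (P - d) else 0) sums S"
  using assms by (subst sums_zero_iff_shift[symmetric, where n = d]) auto

context qhyp_data
begin

definition prefactor :: "nat \<Rightarrow> complex" where
  "prefactor i = X i powi (1 - t) * (\<Prod>l=1..s. qfact q (q * X i / B l) (m l - n i))
     / (\<Prod>l\<in>{1..r} - {i}. qfact q (X i / X l) (n l - n i + 1))"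

definition phi_coeff :: "nat \<Rightarrow> nat \<Rightarrow> complex" where
  "phi_coeff i h = (\<Prod>l=1..s. qfact q (B l / X i) (int h))
     / ((\<Prod>l\<in>{1..r} - {i}. qfact q (q * X l / X i) (int h)) * qfact q q (int h))
     * qsign q h ^ (r - s) * (W * X i powi (int s - int r)) ^ h"

definition phi_BS_coeff :: "nat \<Rightarrow> nat \<Rightarrow> complex" where
  "phi_BS_coeff i h = (\<Prod>l=1..s. qfact q (q * X i / B l * q powi (m l - n i)) (int h))
     / ((\<Prod>l\<in>{1..r} - {i}. qfact q (X i / X l * q powi (n l - n i + 1)) (int h)) * qfact q q (int h))"

text \<open>
  In each factor the prefactor supplies the beginning and the second series the continuation of one shifted
  factorial, whose index then depends only on \<open>j - h\<close>.
\<close>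

lemma product_coeff:
  assumes i: "i \<in> {1..r}"
  shows "prefactor i * phi_coeff i h * phi_BS_coeff i k = \<kappa> i h (int h + int k - n i)"
proof -
  have num: "qfact q (q * X i / B l) (m l + (int h + int k - n i) - int h)
      = qfact q (q * X i / B l) (m l - n i) * qfact q (q * X i / B l * q powi (m l - n i)) (int k)"
    if "l \<in> {1..s}" for l
    using qfact_add[OF q0 numerator[OF i that], of k] by (simp add: algebra_simps)
  have den: "qfact q (X i / X l) (n l + (int h + int k - n i) + 1 - int h)
      = qfact q (X i / X l) (n l - n i + 1) * qfact q (X i / X l * q powi (n l - n i + 1)) (int k)"
    if "l \<in> {1..r} - {i}" for l
    using qfact_add[OF q0 generic_defined[OF i that, of "n l - n i + 1"], of k]
    by (simp add: algebra_simps)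
  have numP: "(\<Prod>l=1..s. qfact q (B l / X i) (int h) * qfact q (q * X i / B l) (m l + (int h + int k - n i) - int h))
     = (\<Prod>l=1..s. qfact q (B l / X i) (int h)) * ((\<Prod>l=1..s. qfact q (q * X i / B l) (m l - n i))
        * (\<Prod>l=1..s. qfact q (q * X i / B l * q powi (m l - n i)) (int k)))"
    unfolding prod.distrib[symmetric] by (intro prod.cong refl) (simp only: num)
  have denP: "(\<Prod>l\<in>{1..r} - {i}. qfact q (q * X l / X i) (int h)
          * qfact q (X i / X l) (n l + (int h + int k - n i) + 1 - int h))
     = (\<Prod>l\<in>{1..r} - {i}. qfact q (q * X l / X i) (int h)) * ((\<Prod>l\<in>{1..r} - {i}. qfact q (X i / X l) (n l - n i + 1))
        * (\<Prod>l\<in>{1..r} - {i}. qfact q (X i / X l * q powi (n l - n i + 1)) (int k)))"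
    unfolding prod.distrib[symmetric] by (intro prod.cong refl) (simp only: den)
  have "n i + (int h + int k - n i) - int h = int k" by simp
  then show ?thesis
    unfolding \<kappa>_def numP denP prefactor_def phi_coeff_def phi_BS_coeff_def
    by (simp add: divide_inverse mult_ac)
qed

lemma q_power_tendsto: "(\<lambda>k. c * q ^ k) \<longlonglongrightarrow> 0"
  using tendsto_mult[OF tendsto_const LIMSEQ_power_zero[OF q1], of c] by simp

lemma prod_factor_tendsto: "(\<lambda>k. \<Prod>l\<in>A. 1 - c l * q ^ k) \<longlonglongrightarrow> 1"
proof -
  have "(\<lambda>k. \<Prod>l\<in>A. 1 - c l * q ^ k) \<longlonglongrightarrow> (\<Prod>l\<in>A. 1 - 0)"
    by (intro tendsto_prod tendsto_diff tendsto_const q_power_tendsto)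
  then show ?thesis by simp
qed

text \<open>
  The ratio of successive terms tends to \<open>0\<close> because the exponent \<open>r - s\<close> of \<open>- q\<^bsup>k\<^esup>\<close> is positive.
\<close>

lemma summable_phi: "summable (\<lambda>h. norm (phi_coeff i h * z ^ h))"
proof (rule summable_norm_ratio_limit)
  define w where "w = W * X i powi (int s - int r) * z"
  \<comment> \<open>the factor of \<open>(q; q)\<^sub>k\<close> is written as a product over a singleton to share \<open>prod_factor_tendsto\<close>\<close>
  let ?g = "\<lambda>k. (\<Prod>l=1..s. 1 - B l / X i * q ^ k) / ((\<Prod>l\<in>{1..r} - {i}. 1 - q * X l / X i * q ^ k)
      * (\<Prod>l\<in>{()}. 1 - q * q ^ k)) * (- 1 * q ^ k) ^ (r - s) * w"
  show "phi_coeff i (Suc k) * z ^ Suc k = phi_coeff i k * z ^ k * ?g k" for k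
  proof -
    have "(- (q ^ k) * qsign q k) ^ (r - s) = (- 1 * q ^ k) ^ (r - s) * qsign q k ^ (r - s)"
      by (simp only: power_mult_distrib[symmetric]) simp
    then show ?thesis
      unfolding phi_coeff_def qfact_int_Suc qsign_Suc prod.distrib w_def
      by (simp add: divide_inverse mult_ac power_Suc)
  qed
  have "?g \<longlonglongrightarrow> 1 / (1 * 1) * 0 ^ (r - s) * w"
    by (intro tendsto_intros prod_factor_tendsto q_power_tendsto) simp
  then show "?g \<longlonglongrightarrow> 0" using sr by (simp add: power_0_left)
qed simp

lemma summable_phi_BS:
  assumes "norm z < 1"
  shows "summable (\<lambda>h. norm (phi_BS_coeff i h * z ^ h))"
proof (rule summable_norm_ratio_limit)
  let ?g = "\<lambda>k. (\<Prod>l=1..s. 1 - q * X i / B l * q powi (m l - n i) * q ^ k)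
      / ((\<Prod>l\<in>{1..r} - {i}. 1 - X i / X l * q powi (n l - n i + 1) * q ^ k)
         * (\<Prod>l\<in>{()}. 1 - q * q ^ k)) * z"
  show "phi_BS_coeff i (Suc k) * z ^ Suc k = phi_BS_coeff i k * z ^ k * ?g k" for k
    unfolding phi_BS_coeff_def qfact_int_Suc prod.distrib
    by (simp add: divide_inverse mult_ac power_Suc)
  have "?g \<longlonglongrightarrow> 1 / (1 * 1) * z"
    by (intro tendsto_intros prod_factor_tendsto) simp
  then show "?g \<longlonglongrightarrow> z" by simp
qed (rule assms)

text \<open>
  Multiplication by \<open>z\<^bsup>N\<^esup>\<close> turns all summands, whose series start at \<open>z\<^bsup>-n\<^sub>i\<^esup>\<close>, into power series.
\<close>

lemma product_series_sums:
  assumes i: "i \<in> {1..r}" and z: "norm z < 1" "z \<noteq> 0" and n_le: "n i \<le> N"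
  shows "(\<lambda>P. (\<Sum>h<nat (n i + (int P - N) + 1). \<kappa> i h (int P - N)) * z ^ P) sums
     (z powi N * (prefactor i * z powi (- n i) * (\<Sum>h. phi_coeff i h * z ^ h) * (\<Sum>h. phi_BS_coeff i h * z ^ h)))"
proof -
  \<comment> \<open>the \<open>i\<close>-th series starts \<open>d\<close> places after the first of them\<close>
  define d where "d = nat (N - n i)"
  have "(\<lambda>p. \<Sum>h\<le>p. (phi_coeff i h * z ^ h) * (phi_BS_coeff i (p - h) * z ^ (p - h))) sums
      ((\<Sum>h. phi_coeff i h * z ^ h) * (\<Sum>h. phi_BS_coeff i h * z ^ h))"
    by (intro Cauchy_product_sums summable_phi summable_phi_BS z)
  then have "(\<lambda>p. z ^ d * prefactor i * (\<Sum>h\<le>p. (phi_coeff i h * z ^ h) * (phi_BS_coeff i (p - h) * z ^ (p - h)))) sums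
      (z ^ d * prefactor i * ((\<Sum>h. phi_coeff i h * z ^ h) * (\<Sum>h. phi_BS_coeff i h * z ^ h)))"
    by (rule sums_mult)
  from sums_shift_right[OF this, of d]
  have "(\<lambda>P. if d \<le> P then z ^ d * prefactor i
        * (\<Sum>h\<le>P - d. (phi_coeff i h * z ^ h) * (phi_BS_coeff i (P - d - h) * z ^ (P - d - h))) else 0) sums
      (z ^ d * prefactor i * ((\<Sum>h. phi_coeff i h * z ^ h) * (\<Sum>h. phi_BS_coeff i h * z ^ h)))" .
  also have "(\<lambda>P. if d \<le> P then z ^ d * prefactor i
        * (\<Sum>h\<le>P - d. (phi_coeff i h * z ^ h) * (phi_BS_coeff i (P - d - h) * z ^ (P - d - h))) else 0)
      = (\<lambda>P. (\<Sum>h<nat (n i + (int P - N) + 1). \<kappa> i h (int P - N)) * z ^ P)"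
  proof
    fix P
    show "(if d \<le> P then z ^ d * prefactor i
        * (\<Sum>h\<le>P - d. (phi_coeff i h * z ^ h) * (phi_BS_coeff i (P - d - h) * z ^ (P - d - h))) else 0)
      = (\<Sum>h<nat (n i + (int P - N) + 1). \<kappa> i h (int P - N)) * z ^ P"
    proof (cases "d \<le> P")
      case True
      have "z ^ d * prefactor i * ((phi_coeff i h * z ^ h) * (phi_BS_coeff i (P - d - h) * z ^ (P - d - h)))
          = \<kappa> i h (int P - N) * z ^ P" if "h \<le> P - d" for h
      proof -
        have zP: "z ^ P = z ^ d * (z ^ h * z ^ (P - d - h))"
          using that True by (simp flip: power_add)
        have j: "int h + int (P - d - h) - n i = int P - N"
          using that True n_le by (simp add: d_def of_nat_diff)
        show ?thesis
          unfolding zP product_coeff[OF i, of h "P - d - h", unfolded j, symmetric] by (simp only: mult_ac)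
      qed
      moreover have "{..P - d} = {..<nat (n i + (int P - N) + 1)}"
        using True n_le by (auto simp: d_def)
      ultimately show ?thesis using True
        by (simp only: if_True sum_distrib_left sum_distrib_right) (intro sum.cong, auto)
    next
      case False
      then have "nat (n i + (int P - N) + 1) = 0" by (simp add: d_def)
      then show ?thesis using False by simp
    qed
  qed
  also have "z ^ d = z powi N * z powi (- n i)"
    using z n_le power_int_add[of z N "- n i"] power_int_of_nat[of z d] by (simp add: d_def)
  finally show ?thesis by (simp only: mult_ac)
qed

lemma \<alpha>_eq_0:
  assumes "\<And>i. i \<in> {1..r} \<Longrightarrow> n i + j < 0"
  shows "\<alpha> j = 0"
proof -
  have "nat (n i + j + 1) = 0" if "i \<in> {1..r}" for i using assms[OF that] by simp
  then show ?thesis unfolding \<alpha>_def by (intro sum.neutral) auto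
qed

text \<open>
  Multiplying the series of the \<open>\<alpha> j\<close> by the polynomial \<open>(z; q)\<^sub>T\<close> convolves its coefficients with those of the
  \<open>q\<close>-binomial theorem; \<open>vanish\<close> cuts the result off at \<open>K\<close>.
\<close>

lemma generating_function:
  assumes z: "norm z < 1" "z \<noteq> 0" and n_le: "\<And>i. i \<in> {1..r} \<Longrightarrow> n i \<le> N"
    and vanish: "\<And>k. K < k \<Longrightarrow> (\<Sum>c\<le>T. qbinomial q (int T) (int c) * qsign q c * \<alpha> (k - int c)) = 0"
  shows "qfact q z (int T) * (\<Sum>i=1..r. prefactor i * z powi (- n i)
            * (\<Sum>h. phi_coeff i h * z ^ h) * (\<Sum>h. phi_BS_coeff i h * z ^ h))
     = (\<Sum>k=- N..K. (\<Sum>c\<le>T. qbinomial q (int T) (int c) * qsign q c * \<alpha> (k - int c)) * z powi k)"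
proof -
  define w where "w c = qbinomial q (int T) (int c) * qsign q c" for c
  define \<gamma> where "\<gamma> k = (\<Sum>c\<le>T. w c * \<alpha> (k - int c))" for k
  define S where "S = (\<Sum>i=1..r. prefactor i * z powi (- n i)
            * (\<Sum>h. phi_coeff i h * z ^ h) * (\<Sum>h. phi_BS_coeff i h * z ^ h))"
  have "(\<lambda>P. \<Sum>i=1..r. (\<Sum>h<nat (n i + (int P - N) + 1). \<kappa> i h (int P - N)) * z ^ P) sums (z powi N * S)"
    unfolding S_def sum_distrib_left by (intro sums_sum product_series_sums z n_le)
  then have \<alpha>_sums: "(\<lambda>P. \<alpha> (int P - N) * z ^ P) sums (z powi N * S)"
    by (simp add: \<alpha>_def sum_distrib_right)
  have "(\<lambda>P. \<Sum>c\<le>T. if c \<le> P then w c * z ^ c * (\<alpha> (int (P - c) - N) * z ^ (P - c)) else 0) sums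
      (\<Sum>c\<le>T. w c * z ^ c * (z powi N * S))"
    by (intro sums_sum sums_shift_right[where f = "\<lambda>P. w _ * z ^ _ * (\<alpha> (int P - N) * z ^ P)"] sums_mult \<alpha>_sums)
  also have "(\<lambda>P. \<Sum>c\<le>T. if c \<le> P then w c * z ^ c * (\<alpha> (int (P - c) - N) * z ^ (P - c)) else 0)
      = (\<lambda>P. \<gamma> (int P - N) * z ^ P)"
  proof
    fix P
    have "(if c \<le> P then w c * z ^ c * (\<alpha> (int (P - c) - N) * z ^ (P - c)) else 0)
        = w c * \<alpha> (int P - N - int c) * z ^ P" for c
    proof (cases "c \<le> P")
      case True
      then have "z ^ P = z ^ c * z ^ (P - c)" by (simp flip: power_add)
      moreover have "int (P - c) - N = int P - N - int c" using True by simp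
      ultimately show ?thesis using True by (simp only: if_True mult_ac)
    next
      case False
      \<comment> \<open>the index lies below \<open>- N\<close>, where no pole chain has started\<close>
      have "\<alpha> (int P - N - int c) = 0" using False n_le by (intro \<alpha>_eq_0) force
      then show ?thesis using False by simp
    qed
    then show "(\<Sum>c\<le>T. if c \<le> P then w c * z ^ c * (\<alpha> (int (P - c) - N) * z ^ (P - c)) else 0)
        = \<gamma> (int P - N) * z ^ P"
      by (simp add: \<gamma>_def sum_distrib_right)
  qed
  also have "(\<Sum>c\<le>T. w c * z ^ c * (z powi N * S)) = z powi N * (qfact q z (int T) * S)"
    unfolding q_binomial_theorem[OF q1] w_def[symmetric]
    by (simp add: sum_distrib_left sum_distrib_right mult_ac)
  finally have "(\<lambda>P. \<gamma> (int P - N) * z ^ P) sums (z powi N * (qfact q z (int T) * S))" .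
  moreover have "(\<lambda>P. \<gamma> (int P - N) * z ^ P) sums (\<Sum>P<nat (K + N + 1). \<gamma> (int P - N) * z ^ P)"
    using vanish by (intro sums_finite) (auto simp: \<gamma>_def w_def)
  ultimately have "z powi N * (qfact q z (int T) * S) = (\<Sum>P<nat (K + N + 1). \<gamma> (int P - N) * z ^ P)"
    by (rule sums_unique2)
  also have "\<dots> = (\<Sum>k=- N..K. \<gamma> k * z powi (k + N))"
    by (rule sum.reindex_bij_witness[of _ "\<lambda>k. nat (k + N)" "\<lambda>P. int P - N"]) auto
  also have "\<dots> = z powi N * (\<Sum>k=- N..K. \<gamma> k * z powi k)"
    using z by (simp add: sum_distrib_left power_int_add mult_ac)
  finally show ?thesis using z by (simp add: \<gamma>_def w_def S_def)
qed

end

section \<open>Hypergeometric functions of powers of the base\<close>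

lemma qpow_add: "qpow lq (x + y) = qpow lq x * qpow lq y"
  by (simp add: qpow_def distrib_right exp_add)

lemma qpow_diff: "qpow lq (x - y) = qpow lq x / qpow lq y"
  by (simp add: qpow_def left_diff_distrib exp_diff)

lemma qpow_minus: "qpow lq (- x) = 1 / qpow lq x"
  by (simp add: qpow_def exp_minus divide_inverse)

lemma qpow_nonzero: "qpow lq x \<noteq> 0"
  by (simp add: qpow_def)

lemma qpow_mult_of_int: "qpow lq (x * of_int k) = qpow lq x powi k"
  by (simp add: qpow_def exp_power_int mult_ac)

lemma qpow_of_int: "exp lq = q \<Longrightarrow> qpow lq (of_int k) = q powi k"
  by (metis exp_power_int qpow_def)

lemma qpow_1: "exp lq = q \<Longrightarrow> qpow lq 1 = q"
  by (simp add: qpow_def)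

lemma prod_list_idx: "prod_list (map g (map f (idx k))) = (\<Prod>l=1..k. g (f l))"
  using prod.distinct_set_conv_list[of "idx k" "\<lambda>l. g (f l)"]
  by (simp add: idx_def o_def atLeastLessThanSuc_atLeastAtMost del: upt_Suc)

lemma prod_list_idx_except:
  "prod_list (map g (map f (idx_except k i))) = (\<Prod>l\<in>{1..k} - {i}. g (f l))"
proof -
  have "set (idx_except k i) = {1..k} - {i}" "distinct (idx_except k i)"
    by (auto simp: idx_except_def)
  then show ?thesis
    using prod.distinct_set_conv_list[of "idx_except k i" "\<lambda>l. g (f l)"] by (simp add: o_def)
qed

lemma length_idx: "length (idx k) = k"
  by (simp add: idx_def)

lemma length_idx_except:
  assumes "i \<in> {1..k}"
  shows "length (idx_except k i) = k - 1"
proof -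
  have "set (idx_except k i) = {1..k} - {i}" "distinct (idx_except k i)"
    by (auto simp: idx_except_def)
  then have "length (idx_except k i) = card ({1..k} - {i})" by (metis distinct_card)
  then show ?thesis using assms by simp
qed

text \<open>
  With equally many further upper and lower parameters the quadratic power of \<open>q\<close> is absent.
\<close>

lemma qhyp_terminating:
  assumes "\<forall>h>L. qfact q c (int h) = 0" and "length cs = length ds"
  shows "qhyp q (c # cs) ds x = (\<Sum>h<Suc L. qfact q c (int h) * (\<Prod>c\<leftarrow>cs. qfact q c (int h))
      / ((\<Prod>d\<leftarrow>ds. qfact q d (int h)) * qfact q q (int h)) * x ^ h)"
proof -
  have "qhyp q (c # cs) ds x = (\<Sum>h. qfact q c (int h) * (\<Prod>c\<leftarrow>cs. qfact q c (int h))
      / ((\<Prod>d\<leftarrow>ds. qfact q d (int h)) * qfact q q (int h)) * x ^ h)"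
    using assms(2) by (simp add: qhyp_def)
  also have "\<dots> = (\<Sum>h<Suc L. qfact q c (int h) * (\<Prod>c\<leftarrow>cs. qfact q c (int h))
      / ((\<Prod>d\<leftarrow>ds. qfact q d (int h)) * qfact q q (int h)) * x ^ h)"
    using assms(1) by (intro suminf_finite) auto
  finally show ?thesis .
qed

lemma qsign_powi:
  "q powi (int c * (int c - 1) div 2) * (-1) powi (int c) = qsign q c"
proof -
  have "int c * (int c - 1) div 2 = int (c * (c - 1) div 2)"
    by (cases c) (simp_all add: zdiv_int algebra_simps)
  then show ?thesis by (simp add: qsign_def)
qed

locale qhyp_exponents =
  qhyp_data q r s "\<lambda>i. qpow lq (a i)" "\<lambda>l. qpow lq (b l)" m n t
  for q lq :: complex and r s :: nat and a b :: "nat \<Rightarrow> complex"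
    and m n :: "nat \<Rightarrow> int" and t :: int +
  assumes log_q: "exp lq = q"
begin

lemma qpow_parameters:
  "qpow lq (1 - b l + a i) = q * qpow lq (a i) / qpow lq (b l)"
  "qpow lq (a i - a k) = qpow lq (a i) / qpow lq (a k)"
  "qpow lq (b l - a i) = qpow lq (b l) / qpow lq (a i)"
  "qpow lq (1 + a k - a i) = q * qpow lq (a k) / qpow lq (a i)"
  "qpow lq (1 - a i + a k) = q * qpow lq (a k) / qpow lq (a i)"
  "qpow lq (1 - b l + a i + of_int c - of_int d) = q * qpow lq (a i) / qpow lq (b l) * q powi (c - d)"
  "qpow lq (1 - a k + a i + of_int c - of_int d) = qpow lq (a i) / qpow lq (a k) * q powi (c - d + 1)"
  "qpow lq (b l - a i - of_int c - of_int d) = qpow lq (b l) / qpow lq (a i) * q powi (- c - d)"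
  "qpow lq (a k - a i - of_int c - of_int d) = qpow lq (a k) / qpow lq (a i) * q powi (- c - d)"
  "qpow lq (a i * (1 - of_int t)) = qpow lq (a i) powi (1 - t)"
  using q0 qpow_mult_of_int[of lq "a i" "1 - t"]
  by (simp_all add: qpow_add qpow_diff qpow_of_int[OF log_q] qpow_1[OF log_q] power_int_diff
      power_int_add power_int_minus field_simps)

lemma Wconst_eq: "Wconst q lq r s a b t = W"
  by (simp add: Wconst_def W_def qpow_minus prod_dividef)

lemma qhyp_eq:
  assumes "i \<in> {1..r}"
  shows "qhyp q (map (\<lambda>l. qpow lq (b l - a i)) (idx s)) (map (\<lambda>l. qpow lq (1 + a l - a i)) (idx_except r i))
            (Wconst q lq r s a b t * qpow lq ((of_nat s - of_nat r) * a i) * z)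
       = (\<Sum>h. phi_coeff i h * z ^ h)"
proof -
  have len: "1 + length (map (\<lambda>l. qpow lq (1 + a l - a i)) (idx_except r i))
      - length (map (\<lambda>l. qpow lq (b l - a i)) (idx s)) = r - s"
    using sr by (simp add: length_idx length_idx_except[OF assms])
  have pow: "qpow lq ((of_nat s - of_nat r) * a i) = qpow lq (a i) powi (int s - int r)"
    using qpow_mult_of_int[of lq "a i" "int s - int r"] by (simp add: mult.commute)
  show ?thesis
    unfolding qhyp_def len
    unfolding qsign_def[symmetric] prod_list_idx prod_list_idx_except pow Wconst_eq
      phi_coeff_def qpow_parameters
    by (simp add: power_mult_distrib mult.assoc)
qed

lemma qhyp_BS_eq:
  "qhyp_BS q (map (\<lambda>l. qpow lq (1 - b l + a i + of_int (m l) - of_int (n i))) (idx s))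
     (map (\<lambda>l. qpow lq (1 - a l + a i + of_int (n l) - of_int (n i))) (idx_except r i)) z
   = (\<Sum>h. phi_BS_coeff i h * z ^ h)"
  unfolding qhyp_BS_def prod_list_idx prod_list_idx_except phi_BS_coeff_def qpow_parameters ..

lemma beta_term_eq:
  assumes i: "i \<in> {1..r}"
    and lower: "\<And>l h. 0 \<le> j + n i \<Longrightarrow> l \<in> {1..s} \<Longrightarrow> int h \<le> j + n i \<Longrightarrow>
         qfact q (qpow lq (b l - a i - of_int (m l) - of_int j)) (int h) \<noteq> 0"
  shows "beta_term q lq r s a b m n t j i = (\<Sum>h<nat (n i + j + 1). \<kappa> i h j)"
proof (cases "j + n i < 0")
  case True
  then show ?thesis by (simp add: beta_term_def)
next
  case False
  define L where "L = nat (j + n i)"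
  have L: "j + n i = int L" "n i + j = int L" "nat (n i + j + 1) = Suc L" "- j - n i = - int L"
    using False by (auto simp: L_def)
  have zero: "\<forall>h>L. qfact q (q powi (- j - n i)) (int h) = 0"
    unfolding qfact_int L(4) using q0
    by (intro allI impI prod_zero bexI[of _ L]) (auto simp: power_int_minus)
  have len: "length (map (\<lambda>l. qpow lq (b l - a i)) (idx s)
        @ map (\<lambda>l. qpow lq (a l - a i - of_int (n l) - of_int j)) (idx_except r i))
      = length (map (\<lambda>l. qpow lq (b l - a i - of_int (m l) - of_int j)) (idx s)
        @ map (\<lambda>l. qpow lq (1 - a i + a l)) (idx_except r i))"
    by simp
  have \<kappa>: "\<kappa> i h j = qpow lq (a i) powi (1 - t) * (\<Prod>l=1..s. qfact q (q * qpow lq (a i) / qpow lq (b l)) (m l + j))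
     / (qfact q q (j + n i) * (\<Prod>l\<in>{1..r} - {i}. qfact q (qpow lq (a i) / qpow lq (a l)) (n l + j + 1)))
     * (qfact q (q powi (- j - n i)) (int h) * ((\<Prod>l=1..s. qfact q (qpow lq (b l) / qpow lq (a i)) (int h))
          * (\<Prod>l\<in>{1..r} - {i}. qfact q (qpow lq (a l) / qpow lq (a i) * q powi (- n l - j)) (int h)))
        / ((\<Prod>l=1..s. qfact q (qpow lq (b l) / qpow lq (a i) * q powi (- m l - j)) (int h))
          * (\<Prod>l\<in>{1..r} - {i}. qfact q (q * qpow lq (a l) / qpow lq (a i)) (int h)) * qfact q q (int h))
        * (q powi ((\<Sum>i=1..r. n i) - (\<Sum>l=1..s. m l) + int r - 1 + t + j * (int r - int s))) ^ h)"
    if "h < Suc L" for h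
  proof -
    have h: "int h \<le> n i + j" using that L(2) by simp
    have nz: "qfact q (qpow lq (b l) / qpow lq (a i) * q powi (- m l - j)) (int h) \<noteq> 0" if "l \<in> {1..s}" for l
      using lower[OF _ that, of h] L(1) \<open>h < Suc L\<close> unfolding qpow_parameters by simp
    show ?thesis unfolding add.commute[of j "n i"] by (rule \<kappa>_beta[OF i h nz])
  qed
  show ?thesis
    using False
    unfolding beta_term_def qhyp_terminating[OF zero len] unfolding map_append prod_list.append
      prod_list_idx prod_list_idx_except qpow_parameters L(3)
    by (simp only: if_False sum_distrib_left) (intro sum.cong refl, simp only: \<kappa> lessThan_iff mult.assoc)
qed

text \<open>
  The definition of \<open>beta\<close> starts the sum at \<open>- nmax r n\<close>; the indices below contribute nothing since \<open>\<alpha>\<close> vanishes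
  there.
\<close>

lemma beta_eq:
  assumes n_le: "\<And>i. i \<in> {1..r} \<Longrightarrow> n i \<le> nmax r n"
    and terms: "\<And>j. - nmax r n \<le> j \<Longrightarrow> j \<le> k \<Longrightarrow> (\<Sum>i=1..r. beta_term q lq r s a b m n t j i) = \<alpha> j"
  shows "beta q lq r s a b m n t k
     = (\<Sum>c\<le>nat t. qbinomial q (int (nat t)) (int c) * qsign q c * \<alpha> (k - int c))"
proof -
  have T: "max 0 t = int (nat t)" by simp
  let ?w = "\<lambda>j. qbinomial q (int (nat t)) (k - j) * q powi ((k - j) * (k - j - 1) div 2) * (-1) powi (k - j)"
  have "beta q lq r s a b m n t k = (\<Sum>j=max (- nmax r n) (k - int (nat t))..k. ?w j * \<alpha> j)"
    unfolding beta_def T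
  proof (rule sum.cong)
    fix j assume "j \<in> {max (- nmax r n) (k - int (nat t))..k}"
    then have "(\<Sum>i=1..r. beta_term q lq r s a b m n t j i) = \<alpha> j" by (intro terms) auto
    then show "?w j * (\<Sum>i=1..r. beta_term q lq r s a b m n t j i) = ?w j * \<alpha> j" by (simp only:)
  qed simp
  also have "\<dots> = (\<Sum>j=k - int (nat t)..k. ?w j * \<alpha> j)"
  proof (rule sum.mono_neutral_left)
    show "\<forall>j\<in>{k - int (nat t)..k} - {max (- nmax r n) (k - int (nat t))..k}. ?w j * \<alpha> j = 0"
    proof
      fix j assume "j \<in> {k - int (nat t)..k} - {max (- nmax r n) (k - int (nat t))..k}"
      then have "j < - nmax r n" by auto
      then have "\<alpha> j = 0" using n_le by (intro \<alpha>_eq_0) force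
      then show "?w j * \<alpha> j = 0" by simp
    qed
  qed auto
  also have "\<dots> = (\<Sum>c\<le>nat t. ?w (k - int c) * \<alpha> (k - int c))"
    by (rule sum.reindex_bij_witness[of _ "\<lambda>c. k - int c" "\<lambda>j. nat (k - j)"])
      (auto simp: nat_le_iff split: if_splits)
  also have "\<dots> = (\<Sum>c\<le>nat t. qbinomial q (int (nat t)) (int c) * qsign q c * \<alpha> (k - int c))"
    by (intro sum.cong refl) (simp add: qsign_powi[symmetric])
  finally show ?thesis .
qed

end

text \<open>
  Beyond \<open>Kbound\<close>, even the smallest index of the convolution satisfies both conditions of \<open>\<alpha>_convolution_vanishes\<close>.
\<close>

lemma Kbound_less:
  assumes k: "Kbound r s m n t < k" and sr: "s < r"
  shows "(\<Sum>l=1..s. m l) - (\<Sum>i=1..r. n i) - int r - t + 1 < (k - max 0 t) * (int r - int s)"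
    and "\<And>l. l \<in> {1..s} \<Longrightarrow> 0 \<le> m l + (k - max 0 t)"
proof -
  have "pprime r s m n t < k - max 0 t" using k by (auto simp: Kbound_def split: if_splits)
  then have "real_of_int ((\<Sum>l=1..s. m l) - (\<Sum>i=1..r. n i) - int r - t + 1) / real_of_int (int r - int s)
      < real_of_int (k - max 0 t)"
    unfolding pprime_def by (simp only: floor_less_iff)
  moreover have "0 < real_of_int (int r - int s)" using sr by simp
  ultimately have "real_of_int ((\<Sum>l=1..s. m l) - (\<Sum>i=1..r. n i) - int r - t + 1)
      < real_of_int (k - max 0 t) * real_of_int (int r - int s)"
    by (simp only: pos_divide_less_eq)
  then show "(\<Sum>l=1..s. m l) - (\<Sum>i=1..r. n i) - int r - t + 1 < (k - max 0 t) * (int r - int s)"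
    by (simp only: of_int_mult[symmetric] of_int_less_iff)
next
  fix l assume l: "l \<in> {1..s}"
  then have "Min (m ` {1..s}) \<le> m l" by (intro Min_le) auto
  moreover have "- Min (m ` {1..s}) - 1 < k - max 0 t"
    using k l by (auto simp: Kbound_def split: if_splits)
  ultimately show "0 \<le> m l + (k - max 0 t)" by linarith
qed

text \<open>
  Together the two families of lower parameters, for \<open>(i, l)\<close> and for \<open>(l, i)\<close>, exclude all nonzero integer exponents.
\<close>

lemma ratio_not_q_power:
  fixes x y q :: complex
  assumes q: "q \<noteq> 0" and xy: "x \<noteq> 0" "y \<noteq> 0" "x \<noteq> y"
    and pos: "\<And>h. qfact q (q * y / x) (int h) \<noteq> 0"
    and neg: "\<And>h. qfact q (q * x / y) (int h) \<noteq> 0"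
  shows "x / y \<noteq> q powi k"
proof
  assume eq: "x / y = q powi k"
  consider "k = 0" | h where "k = int (Suc h)" | h where "k = - int (Suc h)"
    by (metis int_cases2 not0_implies_Suc of_nat_0 minus_zero)
  then show False
  proof cases
    case 1
    then show False using eq xy by simp
  next
    case 2
    have "y / x = inverse (q ^ Suc h)"
      using eq unfolding 2 power_int_of_nat by (metis inverse_divide)
    then have "y / x * q ^ Suc h = 1" using q by (simp del: power_Suc)
    then have "q * y / x * q ^ h = 1" by (simp add: mult_ac)
    then have "qfact q (q * y / x) (int (Suc h)) = 0" unfolding qfact_int_Suc by simp
    then show False using pos by blast
  next
    case 3
    have "x / y = inverse (q ^ Suc h)"
      using eq unfolding 3 power_int_minus power_int_of_nat .
    then have "x / y * q ^ Suc h = 1" using q by (simp del: power_Suc)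
    then have "q * x / y * q ^ h = 1" by (simp add: mult_ac)
    then have "qfact q (q * x / y) (int (Suc h)) = 0" unfolding qfact_int_Suc by simp
    then show False using neg by blast
  qed
qed

lemma qfact_at_one: "0 < k \<Longrightarrow> qfact q 1 k = 0"
  by (auto simp: qfact_def intro!: prod_zero bexI[of _ 0])

theorem theorem2:
  fixes q lq z :: complex
    and r s :: nat
    and a b :: "nat \<Rightarrow> complex"
    and m n :: "nat \<Rightarrow> int"
    and t :: int
  assumes log_q: "exp lq = q"
    and q: "0 < norm q" "norm q < 1"
    and s_less_r: "s < r"
    and a_diff: "\<And>i j. 1 \<le> i \<Longrightarrow> i < j \<Longrightarrow> j \<le> r \<Longrightarrow> a i - a j \<notin> \<int>"
    and z: "0 < norm z" "norm z < 1"
    \<comment> \<open>no vanishing denominators on the left-hand side\<close>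
    and left_numerator:
      "\<And>i l. i \<in> {1..r} \<Longrightarrow> l \<in> {1..s} \<Longrightarrow>
         qfact_defined q (qpow lq (1 - b l + a i)) (m l - n i)"
    and left_denominator:
      "\<And>i l. i \<in> {1..r} \<Longrightarrow> l \<in> {1..r} - {i} \<Longrightarrow> 0 \<le> n l - n i + 1 \<Longrightarrow>
         qfact q (qpow lq (a i - a l)) (n l - n i + 1) \<noteq> 0"
    and left_lower:
      "\<And>i l (h::nat). i \<in> {1..r} \<Longrightarrow> l \<in> {1..r} - {i} \<Longrightarrow>
         qfact q (qpow lq (1 + a l - a i)) (int h) \<noteq> 0"
    and left_lower_BS:
      "\<And>i l (h::nat). i \<in> {1..r} \<Longrightarrow> l \<in> {1..r} - {i} \<Longrightarrow>
         qfact q (qpow lq (1 - a l + a i + of_int (n l) - of_int (n i))) (int h) \<noteq> 0"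
    \<comment> \<open>no vanishing denominators in the coefficients on the right-hand side, whose
       hypergeometric series end with the term of index \<open>j + n i\<close>\<close>
    and right_numerator:
      "\<And>j i l. - nmax r n \<le> j \<Longrightarrow> j \<le> Kbound r s m n t \<Longrightarrow> i \<in> {1..r} \<Longrightarrow> 0 \<le> j + n i \<Longrightarrow>
         l \<in> {1..s} \<Longrightarrow> qfact_defined q (qpow lq (1 - b l + a i)) (m l + j)"
    and right_denominator:
      "\<And>j i l. - nmax r n \<le> j \<Longrightarrow> j \<le> Kbound r s m n t \<Longrightarrow> i \<in> {1..r} \<Longrightarrow> 0 \<le> j + n i \<Longrightarrow>
         l \<in> {1..r} - {i} \<Longrightarrow> 0 \<le> n l + j + 1 \<Longrightarrow>
         qfact q (qpow lq (a i - a l)) (n l + j + 1) \<noteq> 0"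
    and right_lower_b:
      "\<And>j i l (h::nat). - nmax r n \<le> j \<Longrightarrow> j \<le> Kbound r s m n t \<Longrightarrow> i \<in> {1..r} \<Longrightarrow>
         0 \<le> j + n i \<Longrightarrow> l \<in> {1..s} \<Longrightarrow> int h \<le> j + n i \<Longrightarrow>
         qfact q (qpow lq (b l - a i - of_int (m l) - of_int j)) (int h) \<noteq> 0"
    and right_lower_a:
      "\<And>j i l (h::nat). - nmax r n \<le> j \<Longrightarrow> j \<le> Kbound r s m n t \<Longrightarrow> i \<in> {1..r} \<Longrightarrow>
         0 \<le> j + n i \<Longrightarrow> l \<in> {1..r} - {i} \<Longrightarrow> int h \<le> j + n i \<Longrightarrow>
         qfact q (qpow lq (1 - a i + a l)) (int h) \<noteq> 0"
  shows
    "(\<Sum>i=1..r.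
        qpow lq (a i * (1 - of_int t))
        * (z powi (- n i) * (\<Prod>l=1..s. qfact q (qpow lq (1 - b l + a i)) (m l - n i))
           / (\<Prod>l\<in>{1..r} - {i}. qfact q (qpow lq (a i - a l)) (n l - n i + 1)))
        * qhyp q
            (map (\<lambda>l. qpow lq (b l - a i)) (idx s))
            (map (\<lambda>l. qpow lq (1 + a l - a i)) (idx_except r i))
            (Wconst q lq r s a b t * qpow lq ((of_nat s - of_nat r) * a i) * z)
        * qhyp_BS q
            (map (\<lambda>l. qpow lq (1 - b l + a i + of_int (m l) - of_int (n i))) (idx s))
            (map (\<lambda>l. qpow lq (1 - a l + a i + of_int (n l) - of_int (n i))) (idx_except r i))
            z)
     = 1 / qfact q z (max 0 t)
       * (\<Sum>k = - nmax r n..Kbound r s m n t. beta q lq r s a b m n t k * z powi k)"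
proof -
  have q0: "q \<noteq> 0" and z0: "z \<noteq> 0" using q z by auto
  define X where "X i = qpow lq (a i)" for i
  define B where "B l = qpow lq (b l)" for l
  have lower: "qfact q (q * X l / X i) (int h) \<noteq> 0" if "i \<in> {1..r}" "l \<in> {1..r} - {i}" for i l h
    using left_lower[OF that, of h] by (simp add: qpow_add qpow_diff qpow_1[OF log_q] X_def)
  have distinct: "X i \<noteq> X l" if i: "i \<in> {1..r}" and l: "l \<in> {1..r} - {i}" for i l
  proof
    assume eq: "X i = X l"
    have one: "qpow lq (a i - a l) = 1" "qpow lq (a l - a i) = 1"
      using eq qpow_nonzero by (simp_all add: qpow_diff X_def)
    have il: "l \<in> {1..r}" "i \<in> {1..r} - {l}" using i l by auto
    \<comment> \<open>one of the two indices \<open>n l - n i + 1\<close>, \<open>n i - n l + 1\<close> is positive, and that factorial at \<open>1\<close> is \<open>0\<close>\<close>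
    show False
    proof (cases "n i \<le> n l")
      case True
      then show False using left_denominator[OF i l] qfact_at_one[of "n l - n i + 1" q] one by simp
    next
      case False
      then show False using left_denominator[OF il] qfact_at_one[of "n i - n l + 1" q] one by simp
    qed
  qed
  interpret qhyp_exponents q lq r s a b m n t
  proof
    fix i l k
    show "q \<noteq> 0" "norm q < 1" "s < r" "exp lq = q" by fact+
    show "qpow lq (a i) \<noteq> 0" "qpow lq (b l) \<noteq> 0" by (rule qpow_nonzero)+
    show "qpow lq (a i) / qpow lq (a l) \<noteq> q powi k" if i: "i \<in> {1..r}" and l: "l \<in> {1..r} - {i}"
      unfolding X_def[symmetric]
    proof (rule ratio_not_q_power)
      show "qfact q (q * X i / X l) (int h) \<noteq> 0" for h using i l by (intro lower) auto
    qed (use q0 lower[OF i l] distinct[OF i l] in \<open>simp_all add: X_def qpow_nonzero\<close>)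
    show "qfact_defined q (q * qpow lq (a i) / qpow lq (b l)) (m l - n i)" if "i \<in> {1..r}" "l \<in> {1..s}"
      using left_numerator[OF that] by (simp add: qpow_add qpow_diff qpow_1[OF log_q])
  qed
  define N where "N = nmax r n"
  define K where "K = Kbound r s m n t"
  define T where "T = nat t"
  have T: "max 0 t = int T" by (simp add: T_def)
  have n_le: "n i \<le> N" if "i \<in> {1..r}" for i
    unfolding N_def nmax_def using that by (intro Max_ge) auto
  define S where "S = (\<Sum>i=1..r. prefactor i * z powi (- n i)
            * (\<Sum>h. phi_coeff i h * z ^ h) * (\<Sum>h. phi_BS_coeff i h * z ^ h))"
  have vanish: "(\<Sum>c\<le>T. qbinomial q (int T) (int c) * qsign q c * \<alpha> (k - int c)) = 0" if "K < k" for k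
    unfolding T_def using Kbound_less[OF that[unfolded K_def] s_less_r]
    by (intro \<alpha>_convolution_vanishes) auto
  have coeff: "beta q lq r s a b m n t k
      = (\<Sum>c\<le>T. qbinomial q (int T) (int c) * qsign q c * \<alpha> (k - int c))" if "k \<in> {- N..K}" for k
    unfolding T_def
  proof (rule beta_eq)
    fix j assume j: "- nmax r n \<le> j" "j \<le> k"
    then have "j \<le> Kbound r s m n t" using that by (simp add: K_def)
    then show "(\<Sum>i=1..r. beta_term q lq r s a b m n t j i) = \<alpha> j"
      unfolding \<alpha>_def using right_lower_b j(1) by (intro sum.cong refl beta_term_eq) auto
  qed (use n_le N_def in auto)
  have nz: "qfact q z (int T) \<noteq> 0"
  proof -
    have "1 - z * q ^ k \<noteq> 0" for k
    proof
      assume "1 - z * q ^ k = 0"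
      then have "norm (z * q ^ k) = 1" by (metis norm_one right_minus_eq)
      moreover have "norm (z * q ^ k) \<le> norm z * 1"
        unfolding norm_mult norm_power using q by (intro mult_left_mono power_le_one) auto
      ultimately show False using z by simp
    qed
    then show ?thesis by (simp add: qfact_int)
  qed
  have "qfact q z (int T) * S = (\<Sum>k=- N..K. (\<Sum>c\<le>T. qbinomial q (int T) (int c) * qsign q c * \<alpha> (k - int c)) * z powi k)"
    unfolding S_def by (intro generating_function z z0 n_le vanish)
  also have "\<dots> = (\<Sum>k=- N..K. beta q lq r s a b m n t k * z powi k)"
    by (intro sum.cong refl) (simp only: coeff)
  finally have main: "S = 1 / qfact q z (int T) * (\<Sum>k=- N..K. beta q lq r s a b m n t k * z powi k)"
    using nz by (simp add: field_simps)
  show ?thesis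
    unfolding T N_def[symmetric] K_def[symmetric] main[symmetric] S_def
  proof (rule sum.cong)
    fix i assume i: "i \<in> {1..r}"
    show "qpow lq (a i * (1 - of_int t))
        * (z powi (- n i) * (\<Prod>l=1..s. qfact q (qpow lq (1 - b l + a i)) (m l - n i))
           / (\<Prod>l\<in>{1..r} - {i}. qfact q (qpow lq (a i - a l)) (n l - n i + 1)))
        * qhyp q
            (map (\<lambda>l. qpow lq (b l - a i)) (idx s))
            (map (\<lambda>l. qpow lq (1 + a l - a i)) (idx_except r i))
            (Wconst q lq r s a b t * qpow lq ((of_nat s - of_nat r) * a i) * z)
        * qhyp_BS q
            (map (\<lambda>l. qpow lq (1 - b l + a i + of_int (m l) - of_int (n i))) (idx s))
            (map (\<lambda>l. qpow lq (1 - a l + a i + of_int (n l) - of_int (n i))) (idx_except r i))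
            z
      = prefactor i * z powi (- n i) * (\<Sum>h. phi_coeff i h * z ^ h) * (\<Sum>h. phi_BS_coeff i h * z ^ h)"
      unfolding qhyp_eq[OF i] qhyp_BS_eq unfolding prefactor_def qpow_parameters by (simp add: mult_ac)
  qed simp
qed

end
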